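(* Let $K$ be an algebraically closed field with a nontrivial non-Archimedean valuation $\operatorname{val}$, $1\le d\le n-1$, and $X\le K^n$ a linear subspace of dimension $d+1$ with Plücker coordinates $(q_I)_{I\in\binom{[n]}{d+1}}$. Then, up to tropical scaling, each valuated circuit of $L(X)$ comes from a circuit $C$ of $D_{n-d}(U_{n,n})$ via the formula $$l_C=\bigoplus_{h\in C}\operatorname{val}\Bigl(\sum_{\mathcal{O}}\varepsilon_{\mathcal{O}}\prod_{\substack{e\in C\setminus h\\ e\ne e_h}}q_{[n]\setminus s_{\mathcal{O}}(e)}\Bigr)\odot x_h .$$ Here, for each $h\in C$, the inner sum runs over all orientations $\mathcal{O}$ of the hypergraph with hyperedges $C\setminus h$ having set of roots $I_h$, where $e_h\in C\setminus h$ and $I_h\subset e_h$ of size $n-d-1$ can be chosen arbitrarily.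
   Context: $\overline{\mathbb{R}}=\mathbb{R}\cup\{\infty\}$ with $\oplus=\min$, $\odot=+$. $L(X)=\{Y\in\mathrm{Gr}(d,n):Y\subseteq X\}\subseteq\mathbb{P}^{\binom{n}{d}-1}$ (Plücker embedding), which is a projective linear space of dimension $d$. For an $r$-dimensional linear space $Z\le K^N$ with Plücker coordinates $p_J$, its valuated circuits are the tropical linear forms $\bigoplus_{j\in I}\operatorname{val}(p_{I\setminus j})\odot x_j$, $I\in\binom{[N]}{r+1}$, that are not identically $\infty$. For $L(X)$ the coordinates are indexed by $\binom{[n]}{d}$, and for an $(n-d)$-subset $h$ of $[n]$ one writes $x_h$ for the coordinate $x_{[n]\setminus h}$. $D_{n-d}(U_{n,n})$ (Dilworth truncation of the free matroid) is the matroid on the ground set $\binom{[n]}{n-d}$ in which a collection $\{h_1,\dots,h_m\}$ is independent iff every nonempty subcollection of $s$ members has union of cardinality at least $n-d-1+s$. It has rank $d+1$. Hypergraph notions: let $H$ be a hypergraph on $[n]$ with distinct hyperedges $h_1,\dots,h_k$ of size $n-d$ listed in reverse lexicographic order. An orientation $\mathcal{O}$ is a choice of targets $t_{\mathcal{O}}(h_i)\in h_i$, pairwise distinct; the sources are $s_{\mathcal{O}}(h_i)=h_i\setminus\{t_{\mathcal{O}}(h_i)\}$; the roots are $r(\mathcal{O})=\bigcup_is_{\mathcal{O}}(h_i)\setminus\{t_{\mathcal{O}}(h_1),\dots,t_{\mathcal{O}}(h_k)\}$; the target map is $\pi_{\mathcal{O}}:i\mapsto t_{\mathcal{O}}(h_i)$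 with $\operatorname{sign}(\pi_{\mathcal{O}})=(-1)^{\#\text{inversions}}$; and $$\varepsilon_{\mathcal{O}}=(-1)^{\sum_i|s_{\mathcal{O}}(h_i)\cap[t_{\mathcal{O}}(h_i)]|}\operatorname{sign}(\pi_{\mathcal{O}}).$$ *)

theory Defs
  imports
    "HOL-Library.Function_Algebras"
    "HOL-Library.FuncSet"
    "HOL-Library.Extended_Real"
    "HOL-Library.Ramsey"
    "HOL-Computational_Algebra.Polynomial"
    "Jordan_Normal_Form.Determinant"
begin

section \<open>Tropical linear forms and valuations\<close>

text \<open>
  The tropical semiring is the part \<open>\<real> \<union> {\<infinity>}\<close> of \<^typ>\<open>ereal\<close>, with tropical sum the infimum
  and tropical product the addition.  The coefficients below are values of a valuation, hence
  never \<open>-\<infinity>\<close>; a form is a function of the point \<open>x\<close>.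
\<close>

definition trop_form :: "'i set \<Rightarrow> ('i \<Rightarrow> ereal) \<Rightarrow> ('i \<Rightarrow> ereal) \<Rightarrow> ereal" where
  "trop_form S a = (\<lambda>x. INF j\<in>S. a j + x j)"

definition nonarch_valuation :: "('k::field \<Rightarrow> ereal) \<Rightarrow> bool" where
  "nonarch_valuation v \<longleftrightarrow>
     (\<forall>a. v a \<noteq> -\<infinity>) \<and>
     (\<forall>a. v a = \<infinity> \<longleftrightarrow> a = 0) \<and>
     (\<forall>a b. v (a * b) = v a + v b) \<and>
     (\<forall>a b. min (v a) (v b) \<le> v (a + b))"

definition nontrivial_valuation :: "('k::field \<Rightarrow> ereal) \<Rightarrow> bool" where
  "nontrivial_valuation v \<longleftrightarrow> (\<exists>a. a \<noteq> 0 \<and> v a \<noteq> 0)"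


section \<open>Linear subspaces of coordinate spaces\<close>

definition coord_scale :: "'k::field \<Rightarrow> ('i \<Rightarrow> 'k) \<Rightarrow> ('i \<Rightarrow> 'k)" where
  "coord_scale c x = (\<lambda>i. c * x i)"

global_interpretation coord: vector_space coord_scale
  by unfold_locales (auto simp: coord_scale_def algebra_simps)

definition coord_space :: "'i set \<Rightarrow> ('i \<Rightarrow> 'k::field) set" where
  "coord_space E = {x. \<forall>i. i \<notin> E \<longrightarrow> x i = 0}"

definition Gr :: "nat \<Rightarrow> nat \<Rightarrow> (nat \<Rightarrow> 'k::field) set set" where
  "Gr r n = {Y. coord.subspace Y \<and> Y \<subseteq> coord_space {1..n} \<and> coord.dim Y = r}"

text \<open>
  The vector of maximal minors of the matrix with rows \<open>bs\<close>, where \<open>es\<close> lists the column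
  labels in their chosen order.  It is an element of the coordinate space indexed by the
  \<open>length bs\<close>-subsets of \<open>set es\<close>.
\<close>

definition maximal_minors :: "'i list \<Rightarrow> ('i \<Rightarrow> 'k::field) list \<Rightarrow> 'i set \<Rightarrow> 'k" where
  "maximal_minors es bs = (\<lambda>J.
     if J \<in> nsets (set es) (length bs)
     then det (mat (length bs) (length bs) (\<lambda>(i, j). (bs ! i) (filter (\<lambda>e. e \<in> J) es ! j)))
     else 0)"

text \<open>
  Pluecker coordinates are determined up to a common nonzero factor, through the choice
  of the basis \<open>bs\<close>.
\<close>

definition plucker_coords ::
    "'i list \<Rightarrow> ('i \<Rightarrow> 'k::field) set \<Rightarrow> ('i set \<Rightarrow> 'k) \<Rightarrow> bool" where
  "plucker_coords es V p \<longleftrightarrow>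
     (\<exists>bs. distinct bs \<and> coord.independent (set bs) \<and> coord.span (set bs) = V \<and>
           p = maximal_minors es bs)"

text \<open>
  The valuated circuits of \<open>Z\<close>, a linear subspace of the coordinate space indexed by the finite
  set \<open>E\<close>.  Another enumeration \<open>es\<close> of \<open>E\<close> only changes signs of the coordinates, which the
  valuation does not see.
\<close>

definition valuated_circuits ::
    "('k::field \<Rightarrow> ereal) \<Rightarrow> 'i set \<Rightarrow> ('i \<Rightarrow> 'k) set \<Rightarrow> (('i \<Rightarrow> ereal) \<Rightarrow> ereal) set" where
  "valuated_circuits v E Z =
     {f. \<exists>es p I. distinct es \<and> set es = E \<and> plucker_coords es Z p \<and>
           I \<in> nsets E (coord.dim Z + 1) \<and>
           f = trop_form I (\<lambda>j. v (p (I - {j}))) \<and>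
           f \<noteq> (\<lambda>x. \<infinity>)}"

text \<open>
  The affine cone over the image of \<open>{Y \<in> Gr d n. Y \<subseteq> X}\<close> under the Pluecker embedding, that is,
  the linear space whose projectivization is this image when \<open>X\<close> has dimension \<open>d + 1\<close>.
\<close>

definition L_cone :: "nat \<Rightarrow> nat \<Rightarrow> (nat \<Rightarrow> 'k::field) set \<Rightarrow> (nat set \<Rightarrow> 'k) set" where
  "L_cone d n X = insert 0 {p. \<exists>Y\<in>Gr d n. Y \<subseteq> X \<and> plucker_coords [1..<Suc n] Y p}"


section \<open>The Dilworth truncation of the free matroid\<close>

definition dilworth_indep :: "nat \<Rightarrow> nat \<Rightarrow> nat set set \<Rightarrow> bool" where
  "dilworth_indep d n F \<longleftrightarrow>
     F \<subseteq> nsets {1..n} (n - d) \<and>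
     (\<forall>G. G \<subseteq> F \<and> G \<noteq> {} \<longrightarrow> n - d - 1 + card G \<le> card (\<Union>G))"

definition dilworth_circuit :: "nat \<Rightarrow> nat \<Rightarrow> nat set set \<Rightarrow> bool" where
  "dilworth_circuit d n C \<longleftrightarrow>
     C \<subseteq> nsets {1..n} (n - d) \<and> \<not> dilworth_indep d n C \<and>
     (\<forall>F. F \<subset> C \<longrightarrow> dilworth_indep d n F)"


section \<open>Orientations of hypergraphs\<close>

text \<open>
  A hypergraph is its set \<open>H\<close> of hyperedges and an orientation is its target function \<open>t\<close>.
\<close>

definition orientations :: "nat set set \<Rightarrow> (nat set \<Rightarrow> nat) set" where
  "orientations H = {t \<in> (\<Pi>\<^sub>E e\<in>H. e). inj_on t H}"

definition sources :: "(nat set \<Rightarrow> nat) \<Rightarrow> nat set \<Rightarrow> nat set" where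
  "sources t e = e - {t e}"

definition roots :: "nat set set \<Rightarrow> (nat set \<Rightarrow> nat) \<Rightarrow> nat set" where
  "roots H t = (\<Union>e\<in>H. sources t e) - t ` H"

text \<open>
  Reverse lexicographic order on sets of equal size: the larger set is the one containing
  the largest element in which the two differ.
\<close>

definition revlex_less :: "nat set \<Rightarrow> nat set \<Rightarrow> bool" where
  "revlex_less A B \<longleftrightarrow> A \<noteq> B \<and> Max ((A - B) \<union> (B - A)) \<in> B"

definition inversions :: "nat set set \<Rightarrow> (nat set \<Rightarrow> nat) \<Rightarrow> (nat set \<times> nat set) set" where
  "inversions H t = {(e, f). e \<in> H \<and> f \<in> H \<and> revlex_less e f \<and> t f < t e}"

definition orientation_sign :: "nat set set \<Rightarrow> (nat set \<Rightarrow> nat) \<Rightarrow> int" where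
  "orientation_sign H t =
     (-1) ^ (\<Sum>e\<in>H. card (sources t e \<inter> {1..t e})) * (-1) ^ card (inversions H t)"

definition orientation_sum ::
    "nat \<Rightarrow> (nat set \<Rightarrow> 'k::field) \<Rightarrow> nat set set \<Rightarrow> nat set \<Rightarrow> nat set \<Rightarrow> 'k" where
  "orientation_sum n q H e\<^sub>0 I\<^sub>0 =
     (\<Sum>t \<in> {t \<in> orientations H. roots H t = I\<^sub>0}.
        of_int (orientation_sign H t) * (\<Prod>e\<in>H - {e\<^sub>0}. q ({1..n} - sources t e)))"

text \<open>
  The form \<open>l_C\<close> for the choices \<open>h \<mapsto> eh h\<close> and \<open>h \<mapsto> Ih h\<close>.  Its variables are
  indexed by \<open>d\<close>-subsets of \<open>{1..n}\<close>, so that \<open>x_h\<close> is the coordinate of the complement of \<open>h\<close>.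
\<close>

definition circuit_form ::
    "('k::field \<Rightarrow> ereal) \<Rightarrow> nat \<Rightarrow> (nat set \<Rightarrow> 'k) \<Rightarrow> nat set set \<Rightarrow>
     (nat set \<Rightarrow> nat set) \<Rightarrow> (nat set \<Rightarrow> nat set) \<Rightarrow> (nat set \<Rightarrow> ereal) \<Rightarrow> ereal" where
  "circuit_form v n q C eh Ih = (\<lambda>x.
     trop_form C (\<lambda>h. v (orientation_sum n q (C - {h}) (eh h) (Ih h)))
       (\<lambda>h. x ({1..n} - h)))"

definition admissible_choice ::
    "nat \<Rightarrow> nat \<Rightarrow> nat set set \<Rightarrow> (nat set \<Rightarrow> nat set) \<Rightarrow> (nat set \<Rightarrow> nat set) \<Rightarrow> bool" where
  "admissible_choice d n C eh Ih \<longleftrightarrow>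
     (\<forall>h\<in>C. eh h \<in> C - {h} \<and> Ih h \<subset> eh h \<and> card (Ih h) = n - d - 1)"

end

theory Submission
  imports Defs
begin

text \<open>
  Let \<open>A\<close> be a matrix with row space \<open>X\<close>. Every set \<open>h\<close> of \<open>n - d\<close> coordinates determines a circuit
  vector \<open>c\<^sub>h\<close> of \<open>X\<close>, supported on \<open>h\<close>, whose entry at \<open>i \<in> h\<close> is up to sign the Pluecker
  coordinate \<open>q\<close> at the complement of \<open>h - {i}\<close>. A hyperplane \<open>Y\<close> of \<open>X\<close> is the kernel of a linear
  form \<open>\<lambda>\<close> on \<open>X\<close>, and its Pluecker coordinate \<open>x\<^sub>h\<close> is \<open>\<lambda> c\<^sub>h\<close>, up to a common factor. So
  the cone over \<open>L(X)\<close> is the dual space of \<open>X\<close> with coordinate functionals \<open>c\<^sub>h\<close>, and its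
  Pluecker coordinate at a family of \<open>d + 1\<close> hyperedges is the determinant of their circuit
  vectors, up to a common factor (\<open>plucker_coords_L_cone\<close>).

  A valuated circuit is given by \<open>d + 2\<close> hyperedges \<open>I\<close>. Their union has at most \<open>n\<close> elements, so \<open>I\<close>
  contains a circuit \<open>C\<close> of the Dilworth truncation. The circuit vectors of \<open>C\<close> are supported on
  \<open>\<Union>C\<close>, a set with \<open>n - d - 2 + card C\<close> elements. The determinant of the circuit vectors
  of \<open>I - {h}\<close> is evaluated by choosing \<open>e \<in> C - {h}\<close> and using an
  instance of the Cauchy--Binet formula (\<open>det_signed_minor_row\<close>): up to sign it equals the
  determinant of the matrix with the rows \<open>c\<^sub>g\<close>, \<open>g \<in> I - {h, e}\<close>, and the columns outside \<open>e\<close>. That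
  matrix is block triangular. If \<open>h \<notin> C\<close> the determinant is zero, so the coefficient at \<open>h\<close> is
  infinite. If \<open>h \<in> C\<close> it factors into the minor for the rows \<open>I - C\<close> and the columns outside
  \<open>\<Union>C\<close>, which depends neither on \<open>h\<close> nor on any choice, and the minor for the rows \<open>C - {h, e}\<close>
  and the columns \<open>\<Union>C - e\<close>.

  The second minor is the orientation sum up to sign (\<open>orientation_sum_eq_ldet\<close>): orientations of
  \<open>C - {h}\<close> with a given root set are the perfect matchings of hyperedges with non-roots,
  which are the terms of the Leibniz formula. The first minor, together with the factor from the
  Pluecker coordinates of the cone, is the tropical scaling; it is nonzero since the
  form is not identically infinite. All identities hold for every \<open>X\<close>, generic or not, since
  they are polynomial.
\<close>

section \<open>Signed maximal minors\<close>

text \<open>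
  For a matrix \<open>B\<close> with \<open>d + 1\<close> rows and \<open>d\<close> columns these are the coefficients of
  \<open>x \<mapsto> det [x | B]\<close>. They generalize the cross product: the vector is orthogonal to all
  columns of \<open>B\<close>.
\<close>

definition signed_minor :: "nat \<Rightarrow> (nat \<Rightarrow> nat \<Rightarrow> 'k::field) \<Rightarrow> nat \<Rightarrow> 'k" where
  "signed_minor d B r = (-1) ^ r * det (mat d d (\<lambda>(i, j). B (insert_index r i) j))"

lemma det_bordered_column:
  "det (mat (Suc d) (Suc d) (\<lambda>(i, j). if j = 0 then x i else B i (j - 1)))
     = (\<Sum>r<Suc d. x r * signed_minor d B r)"
proof -
  let ?N = "mat (Suc d) (Suc d) (\<lambda>(i, j). if j = 0 then x i else B i (j - 1))"
  have "mat_delete ?N r 0 = mat d d (\<lambda>(i, j). B (insert_index r i) j)" if "r < Suc d" for r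
    by (rule eq_matI) (use that in \<open>auto simp: mat_delete_def insert_index_def\<close>)
  then have "cofactor ?N r 0 = signed_minor d B r" if "r < Suc d" for r
    using that by (simp add: cofactor_def signed_minor_def)
  moreover have "det ?N = (\<Sum>r<Suc d. ?N $$ (r, 0) * cofactor ?N r 0)"
    by (rule laplace_expansion_column) auto
  ultimately show ?thesis by simp
qed

lemma det_bordered_row:
  "det (mat (Suc d) (Suc d) (\<lambda>(i, j). if i = 0 then x j else G (i - 1) j))
     = (\<Sum>r<Suc d. x r * signed_minor d (\<lambda>j i. G i j) r)"
proof -
  let ?N = "mat (Suc d) (Suc d) (\<lambda>(i, j). if i = 0 then x j else G (i - 1) j)"
  have "det ?N = det (transpose_mat ?N)"
    by (rule det_transpose[symmetric]) auto
  also have "transpose_mat ?N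
      = mat (Suc d) (Suc d) (\<lambda>(i, j). if j = 0 then x i else G (j - 1) i)"
    by (rule eq_matI) auto
  finally show ?thesis
    by (simp add: det_bordered_column[of d x "\<lambda>j i. G i j"])
qed

lemma signed_minor_orthogonal:
  assumes "j < d"
  shows "(\<Sum>r<Suc d. signed_minor d B r * B r j) = 0"
proof -
  let ?N = "mat (Suc d) (Suc d) (\<lambda>(i, j'). if j' = 0 then B i j else B i (j' - 1))"
  have "col ?N 0 = col ?N (Suc j)"
    by (rule eq_vecI) (use assms in auto)
  then have "det ?N = 0"
    using assms by (intro det_identical_columns[of ?N "Suc d" 0 "Suc j"]) auto
  then show ?thesis
    using det_bordered_column[of d "\<lambda>i. B i j" B] by (simp add: mult.commute)
qed

text \<open>
  This is the case of the Cauchy--Binet formula in which the inner dimension exceeds the outer one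
  by one. If some signed minor of \<open>B\<close> is nonzero, some column completes \<open>B\<close> to an invertible square
  matrix, and the product of the two square matrices is block triangular. If all of them vanish,
  a kernel vector of \<open>G\<close> lies in the column space of \<open>B\<close>, so both sides are zero.
\<close>

lemma det_signed_minor_row:
  fixes B G :: "nat \<Rightarrow> nat \<Rightarrow> 'k::field"
  shows "det (mat (Suc d) (Suc d) (\<lambda>(i, j). if i = 0 then signed_minor d B j else G (i - 1) j))
    = det (mat d d (\<lambda>(i, j). \<Sum>r<Suc d. G i r * B r j))" (is "det ?N = det ?GB")
proof (cases "\<exists>r<Suc d. signed_minor d B r \<noteq> 0")
  case True
  then obtain r0 where r0: "r0 < Suc d" "signed_minor d B r0 \<noteq> 0" by blast
  let ?x = "\<lambda>i. if i = r0 then 1 else 0 :: 'k"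
  let ?P = "mat (Suc d) (Suc d) (\<lambda>(i, j). if j = 0 then ?x i else B i (j - 1))"
  have detP: "det ?P = signed_minor d B r0"
    using r0 by (subst det_bordered_column) (simp add: if_distrib[of "\<lambda>z. z * _"] cong: if_cong)
  have "?N * ?P = four_block_mat (mat 1 1 (\<lambda>_. signed_minor d B r0)) (0\<^sub>m 1 d)
      (mat d 1 (\<lambda>(i, j). G i r0)) ?GB" (is "_ = ?F")
  proof (rule eq_matI)
    fix i j assume "i < dim_row ?F" "j < dim_col ?F"
    then have ij: "i < Suc d" "j < Suc d" by auto
    have "(?N * ?P) $$ (i, j) = (\<Sum>r<Suc d. (if i = 0 then signed_minor d B r else G (i - 1) r)
        * (if j = 0 then ?x r else B r (j - 1)))"
      using ij by (simp add: scalar_prod_def atLeast0LessThan)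
    also have "\<dots> = ?F $$ (i, j)"
    proof (cases "j = 0")
      case True
      then show ?thesis using ij r0
        by (simp add: if_distrib[of "\<lambda>z. _ * z"] sum.delta cong: if_cong)
    next
      case False
      then show ?thesis using ij signed_minor_orthogonal[of "j - 1" d B]
        by (cases "i = 0") (auto simp: atLeast0LessThan)
    qed
    finally show "(?N * ?P) $$ (i, j) = ?F $$ (i, j)" .
  qed auto
  then have "det (?N * ?P) = det ?F" by simp
  moreover have "det ?F = det (mat 1 1 (\<lambda>_. signed_minor d B r0)) * det ?GB"
    by (rule det_four_block_mat_upper_right_zero) auto
  moreover have "det (mat 1 1 (\<lambda>_. signed_minor d B r0)) = signed_minor d B r0"
    by (subst det_single) auto
  moreover have "det (?N * ?P) = det ?N * det ?P"
    by (rule det_mult) auto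
  ultimately show ?thesis using detP r0 by simp
next
  case False
  then have sm: "signed_minor d B r = 0" if "r < Suc d" for r using that by blast
  (* y is orthogonal to the rows of G, so [y | B] u = 0 yields an element of the kernel of G B. *)
  have N0: "det ?N = 0"
    unfolding det_bordered_row by (rule sum.neutral) (use sm in auto)
  obtain y where y: "y \<in> carrier_vec (Suc d)" "y \<noteq> 0\<^sub>v (Suc d)" "?N *\<^sub>v y = 0\<^sub>v (Suc d)"
    using N0 det_0_iff_vec_prod_zero_field[of ?N "Suc d"] by auto
  have Gy: "(\<Sum>r<Suc d. G i r * y $ r) = 0" if "i < d" for i
  proof -
    have "(?N *\<^sub>v y) $ Suc i = 0" using y that by simp
    then show ?thesis using that y(1) by (simp add: scalar_prod_def atLeast0LessThan)
  qed
  let ?Q = "mat (Suc d) (Suc d) (\<lambda>(i, j). if j = 0 then y $ i else B i (j - 1))"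
  have "det ?Q = 0"
    unfolding det_bordered_column by (rule sum.neutral) (use sm in auto)
  then obtain u where u: "u \<in> carrier_vec (Suc d)" "u \<noteq> 0\<^sub>v (Suc d)" "?Q *\<^sub>v u = 0\<^sub>v (Suc d)"
    using det_0_iff_vec_prod_zero_field[of ?Q "Suc d"] by auto
  have Qu: "y $ r * u $ 0 + (\<Sum>j<d. B r j * u $ Suc j) = 0" if "r < Suc d" for r
  proof -
    have "(?Q *\<^sub>v u) $ r = 0" using u that by simp
    then have "(\<Sum>j<Suc d. (if j = 0 then y $ r else B r (j - 1)) * u $ j) = 0"
      using that u(1) by (simp add: scalar_prod_def atLeast0LessThan)
    then show ?thesis by (subst (asm) sum.lessThan_Suc_shift) simp
  qed
  define w where "w = vec d (\<lambda>j. u $ Suc j)"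
  have "w \<noteq> 0\<^sub>v d"
  proof
    assume "w = 0\<^sub>v d"
    then have u0: "u $ Suc j = 0" if "j < d" for j
      using that by (metis index_vec index_zero_vec(1) w_def)
    then have yu: "y $ r * u $ 0 = 0" if "r < Suc d" for r
      using Qu[OF that] by simp
    have "u $ 0 \<noteq> 0"
    proof
      assume "u $ 0 = 0"
      with u0 have "u $ i = 0" if "i < Suc d" for i using that by (cases i) auto
      then have "u = 0\<^sub>v (Suc d)" using u(1) by (intro eq_vecI) auto
      with u(2) show False by simp
    qed
    with yu have "y = 0\<^sub>v (Suc d)" using y(1) by (intro eq_vecI) auto
    with y(2) show False by simp
  qed
  moreover have "?GB *\<^sub>v w = 0\<^sub>v d"
  proof (rule eq_vecI)
    fix i assume "i < dim_vec (0\<^sub>v d :: 'k vec)"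
    then have i: "i < d" by simp
    have "(?GB *\<^sub>v w) $ i = (\<Sum>j<d. (\<Sum>r<Suc d. G i r * B r j) * u $ Suc j)"
      using i by (simp add: scalar_prod_def atLeast0LessThan w_def)
    also have "\<dots> = (\<Sum>r<Suc d. G i r * (\<Sum>j<d. B r j * u $ Suc j))"
      unfolding sum_distrib_left sum_distrib_right by (subst sum.swap) (simp add: mult.assoc)
    also have "\<dots> = (\<Sum>r<Suc d. - (u $ 0) * (G i r * y $ r))"
    proof (rule sum.cong[OF refl])
      fix r assume "r \<in> {..<Suc d}"
      then have "(\<Sum>j<d. B r j * u $ Suc j) = - (y $ r * u $ 0)"
        using Qu[of r] by (simp add: add_eq_0_iff)
      then show "G i r * (\<Sum>j<d. B r j * u $ Suc j) = - (u $ 0) * (G i r * y $ r)"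
        by simp
    qed
    also have "\<dots> = 0"
      using Gy[OF i] unfolding sum_distrib_left[symmetric] by simp
    finally show "(?GB *\<^sub>v w) $ i = (0\<^sub>v d :: 'k vec) $ i" using i by simp
  qed auto
  moreover have "w \<in> carrier_vec d" by (simp add: w_def)
  ultimately have "det ?GB = 0"
    using det_0_iff_vec_prod_zero_field[of ?GB d, OF mat_carrier] by blast
  with N0 show ?thesis by simp
qed

section \<open>Determinants with labelled rows and columns\<close>

text \<open>
  Valuations do not see signs, so all orders of rows and columns are equally good.
\<close>

definition up_to_sign :: "'k::field \<Rightarrow> 'k \<Rightarrow> bool" (infix "\<simeq>" 50) where
  "a \<simeq> b \<longleftrightarrow> a = b \<or> a = - b"

lemma up_to_sign_refl [simp, intro]: "a \<simeq> a"
  by (simp add: up_to_sign_def)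

lemma up_to_sign_sym: "a \<simeq> b \<Longrightarrow> b \<simeq> a"
  by (auto simp: up_to_sign_def)

lemma up_to_sign_trans [trans]: "a \<simeq> b \<Longrightarrow> b \<simeq> c \<Longrightarrow> a \<simeq> c"
  by (auto simp: up_to_sign_def)

lemma up_to_sign_mult: "a \<simeq> b \<Longrightarrow> a' \<simeq> b' \<Longrightarrow> a * a' \<simeq> b * b'"
  by (auto simp: up_to_sign_def)

lemma up_to_sign_0_iff: "a \<simeq> b \<Longrightarrow> a = 0 \<longleftrightarrow> b = 0"
  by (auto simp: up_to_sign_def)

lemma up_to_sign_unit_mult: "s * s = 1 \<Longrightarrow> s * a \<simeq> a"
  by (auto simp: up_to_sign_def square_eq_1_iff)

text \<open>
  Rows and columns are indexed by arbitrary labels, since hyperedges label the rows of the matrices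
  below. The two lists only fix an order; the determinant makes sense when their lengths agree.
\<close>

definition ldet :: "('a \<Rightarrow> 'b \<Rightarrow> 'k::field) \<Rightarrow> 'a list \<Rightarrow> 'b list \<Rightarrow> 'k" where
  "ldet M hs ts = det (mat (length hs) (length hs) (\<lambda>(i, j). M (hs ! i) (ts ! j)))"

lemma ldet_cong:
  assumes "length ts = length hs" and "\<And>h t. h \<in> set hs \<Longrightarrow> t \<in> set ts \<Longrightarrow> M h t = M' h t"
  shows "ldet M hs ts = ldet M' hs ts"
  unfolding ldet_def using assms by (intro arg_cong[of _ _ det] eq_matI) auto

lemma ldet_transpose:
  assumes "length ts = length hs"
  shows "ldet M hs ts = ldet (\<lambda>t h. M h t) ts hs"
proof -
  have "ldet M hs ts
      = det (transpose_mat (mat (length hs) (length hs) (\<lambda>(i, j). M (hs ! i) (ts ! j))))"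
    unfolding ldet_def by (rule det_transpose[symmetric]) auto
  also have "transpose_mat (mat (length hs) (length hs) (\<lambda>(i, j). M (hs ! i) (ts ! j)))
      = mat (length ts) (length ts) (\<lambda>(i, j). M (hs ! j) (ts ! i))"
    by (rule eq_matI) (use assms in auto)
  finally show ?thesis by (simp add: ldet_def)
qed

lemma ldet_reorder_rows:
  assumes "mset hs = mset hs'"
  shows "ldet M hs ts \<simeq> ldet M hs' ts"
proof -
  obtain p where p: "p permutes {..<length hs'}" "permute_list p hs' = hs"
    using mset_eq_permutation[OF assms] by blast
  have len: "length hs = length hs'" using assms by (rule mset_eq_length)
  let ?A = "mat (length hs') (length hs') (\<lambda>(i, j). M (hs' ! i) (ts ! j))"
  have p': "p i < length hs'" "hs' ! p i = hs ! i" if "i < length hs'" for i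
    using p that permutes_in_image[OF p(1), of i] by (auto simp: permute_list_nth[symmetric])
  have "mat (length hs) (length hs) (\<lambda>(i, j). M (hs ! i) (ts ! j))
      = mat (length hs') (length hs') (\<lambda>(i, j). ?A $$ (p i, j))"
    by (rule eq_matI) (use len p' in auto)
  also have "det \<dots> = signof p * det ?A"
    by (rule det_permute_rows) (use p in \<open>auto simp: atLeast0LessThan\<close>)
  finally show ?thesis
    unfolding ldet_def up_to_sign_def sign_def by (auto split: if_splits)
qed

lemma ldet_reorder:
  assumes "mset hs = mset hs'" and "mset ts = mset ts'" and "length ts = length hs"
  shows "ldet M hs ts \<simeq> ldet M hs' ts'"
proof -
  have len: "length hs' = length hs" "length ts' = length ts"
    using assms by (metis mset_eq_length)+
  have "ldet M hs ts \<simeq> ldet M hs' ts" by (rule ldet_reorder_rows) fact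
  also have "ldet M hs' ts = ldet (\<lambda>t h. M h t) ts hs'"
    by (rule ldet_transpose) (use len assms in simp)
  also have "ldet (\<lambda>t h. M h t) ts hs' \<simeq> ldet (\<lambda>t h. M h t) ts' hs'"
    by (rule ldet_reorder_rows) fact
  also have "\<dots> = ldet M hs' ts'"
    by (rule ldet_transpose) (use len assms in simp)
  finally show ?thesis .
qed

lemma ldet_block:
  assumes "length ts1 = length hs1" and "length ts2 = length hs2"
    and "\<And>h t. h \<in> set hs1 \<Longrightarrow> t \<in> set ts2 \<Longrightarrow> M h t = 0"
  shows "ldet M (hs1 @ hs2) (ts1 @ ts2) = ldet M hs1 ts1 * ldet M hs2 ts2"
proof -
  let ?n = "length hs1" and ?m = "length hs2"
  have "mat (?n + ?m) (?n + ?m) (\<lambda>(i, j). M ((hs1 @ hs2) ! i) ((ts1 @ ts2) ! j))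
      = four_block_mat (mat ?n ?n (\<lambda>(i, j). M (hs1 ! i) (ts1 ! j))) (0\<^sub>m ?n ?m)
          (mat ?m ?n (\<lambda>(i, j). M (hs2 ! i) (ts1 ! j))) (mat ?m ?m (\<lambda>(i, j). M (hs2 ! i) (ts2 ! j)))"
    by (rule eq_matI) (use assms in \<open>auto simp: nth_append\<close>)
  then show ?thesis
    unfolding ldet_def length_append
    by (simp add: det_four_block_mat_upper_right_zero[where n = ?n and m = ?m])
qed

lemma ldet_zero_row:
  assumes "length ts = length hs" and "h \<in> set hs" and "\<And>t. t \<in> set ts \<Longrightarrow> M h t = 0"
  shows "ldet M hs ts = 0"
proof -
  obtain i where i: "i < length hs" "hs ! i = h" using assms(2) by (metis in_set_conv_nth)
  let ?A = "mat (length hs) (length hs) (\<lambda>(i, j). M (hs ! i) (ts ! j))"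
  have "det ?A = (\<Sum>j<length hs. ?A $$ (i, j) * cofactor ?A i j)"
    by (rule laplace_expansion_row) (use i in auto)
  also have "\<dots> = 0"
    by (rule sum.neutral) (use i assms in auto)
  finally show ?thesis by (simp add: ldet_def)
qed

text \<open>
  This absorbs the sign \<open>(-1) ^ (i - 1)\<close> of a target \<open>i\<close>, by which the sign of an orientation
  differs from the sign of a cofactor.
\<close>

lemma ldet_scale_columns:
  assumes "length ts = length hs"
  shows "ldet (\<lambda>h t. s t * M h t) hs ts = (\<Prod>t\<leftarrow>ts. s t) * ldet M hs ts"
proof -
  let ?n = "length hs"
  let ?A = "mat ?n ?n (\<lambda>(i, j). M (hs ! i) (ts ! j))"
  have "ldet (\<lambda>h t. s t * M h t) hs ts
      = (\<Sum>p | p permutes {0..<?n}. signof p * (\<Prod>i = 0..<?n. s (ts ! p i) * M (hs ! i) (ts ! p i)))"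
    unfolding ldet_def by (subst det_def'[of _ ?n]) (auto intro!: sum.cong prod.cong simp: permutes_in_image)
  also have "\<dots> = (\<Sum>p | p permutes {0..<?n}. (\<Prod>t\<leftarrow>ts. s t) * (signof p * (\<Prod>i = 0..<?n. M (hs ! i) (ts ! p i))))"
  proof (rule sum.cong[OF refl])
    fix p assume "p \<in> {p. p permutes {0..<?n}}"
    then have "(\<Prod>i = 0..<?n. s (ts ! p i)) = (\<Prod>i = 0..<?n. s (ts ! i))"
      using prod.permute[of p "{0..<?n}" "\<lambda>i. s (ts ! i)"] by (simp add: comp_def)
    also have "\<dots> = (\<Prod>t\<leftarrow>ts. s t)"
      using assms by (simp add: prod.list_conv_set_nth)
    finally show "signof p * (\<Prod>i = 0..<?n. s (ts ! p i) * M (hs ! i) (ts ! p i))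
        = (\<Prod>t\<leftarrow>ts. s t) * (signof p * (\<Prod>i = 0..<?n. M (hs ! i) (ts ! p i)))"
      by (simp add: prod.distrib)
  qed
  also have "\<dots> = (\<Prod>t\<leftarrow>ts. s t) * ldet M hs ts"
    unfolding ldet_def sum_distrib_left[symmetric]
    by (subst det_def'[of ?A ?n]) (auto intro!: sum.cong prod.cong simp: permutes_in_image)
  finally show ?thesis .
qed

section \<open>Orientation sums are determinants\<close>

text \<open>
  The sign of an orientation counts inversions with respect to the reverse lexicographic order of the
  hyperedges, the sign of a permutation with respect to the order of the rows. Such a count uses
  an order only through the direction it gives to each pair, that is, as a tournament. Reversing one
  pair changes the parity of the count for every injective target map at once, so the
  signs for two tournaments differ by a factor that does not depend on the target map.
\<close>

definition tournament :: "'a set \<Rightarrow> ('a \<times> 'a) set \<Rightarrow> bool" where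
  "tournament H R \<longleftrightarrow> R \<subseteq> H \<times> H \<and> asym R \<and> total_on H R"

lemma tournamentI:
  assumes "\<And>x y. (x, y) \<in> R \<Longrightarrow> x \<in> H \<and> y \<in> H \<and> (y, x) \<notin> R"
    and "\<And>x y. x \<in> H \<Longrightarrow> y \<in> H \<Longrightarrow> x \<noteq> y \<Longrightarrow> (x, y) \<in> R \<or> (y, x) \<in> R"
  shows "tournament H R"
  unfolding tournament_def total_on_def
  using assms by (intro conjI asymI subsetI ballI impI) auto

lemma tournamentD:
  assumes "tournament H R" and "(x, y) \<in> R"
  shows "x \<in> H" and "y \<in> H" and "x \<noteq> y" and "(y, x) \<notin> R"
  using assms asymD[of R x y] unfolding tournament_def by auto

lemma tournament_total:
  assumes "tournament H R" and "x \<in> H" and "y \<in> H" and "x \<noteq> y"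
  shows "(x, y) \<in> R \<longleftrightarrow> (y, x) \<notin> R"
  using assms asymD[of R x y] unfolding tournament_def total_on_def by blast

text \<open>
  A factor that is symmetric in the two ends of a pair does not see the direction of the pair.
\<close>

lemma prod_tournament_eq:
  assumes "tournament H R" and "tournament H R'"
    and "\<And>x y. x \<in> H \<Longrightarrow> y \<in> H \<Longrightarrow> x \<noteq> y \<Longrightarrow> g x y = g y x"
  shows "(\<Prod>(x, y)\<in>R. g x y) = (\<Prod>(x, y)\<in>R'. g x y)"
proof -
  define flip where "flip S x = (if x \<in> S then x else prod.swap x)" for S :: "('a \<times> 'a) set" and x
  have step: "flip S' z \<in> S' \<and> flip S (flip S' z) = z \<and> case_prod g (flip S' z) = case_prod g z"
    if S: "tournament H S" "tournament H S'" and z: "z \<in> S" for S S' z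
  proof -
    obtain x y where xy: "z = (x, y)" by (cases z)
    note * = tournamentD[OF S(1) z[unfolded xy]]
    have **: "(x, y) \<in> S' \<longleftrightarrow> (y, x) \<notin> S'"
      using S(2) *(1-3) by (rule tournament_total)
    show ?thesis
    proof (cases "(x, y) \<in> S'")
      case True
      then show ?thesis using z xy by (simp add: flip_def)
    next
      case False
      then show ?thesis using * ** z xy assms(3)[OF *(1-3)] by (simp add: flip_def)
    qed
  qed
  show ?thesis
    by (rule prod.reindex_bij_witness[where i = "flip R" and j = "flip R'"])
       (use step[OF assms(1,2)] step[OF assms(2,1)] in metis)+
qed

lemma tournament_less: "tournament {..<k::nat} {(i, j). i < j \<and> j < k}"
  by (rule tournamentI) auto

lemma tournament_image:
  assumes "tournament A R" and "bij_betw p A B"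
  shows "tournament B ((\<lambda>(x, y). (p x, p y)) ` R)"
proof -
  have inj: "inj_on p A" and B: "B = p ` A" using assms(2) by (auto simp: bij_betw_def)
  have eq: "(p x, p y) \<in> (\<lambda>(x, y). (p x, p y)) ` R \<longleftrightarrow> (x, y) \<in> R" if "x \<in> A" "y \<in> A" for x y
  proof
    assume "(p x, p y) \<in> (\<lambda>(x, y). (p x, p y)) ` R"
    then obtain x' y' where xy: "(x', y') \<in> R" "p x = p x'" "p y = p y'" by auto
    then have "x = x'" "y = y'"
      using tournamentD(1,2)[OF assms(1) xy(1)] that inj by (auto dest: inj_onD)
    then show "(x, y) \<in> R" using xy by simp
  qed auto
  show ?thesis
  proof (rule tournamentI)
    fix u w assume "(u, w) \<in> (\<lambda>(x, y). (p x, p y)) ` R"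
    then obtain x y where xy: "(x, y) \<in> R" "u = p x" "w = p y" by auto
    note R = tournamentD[OF assms(1) xy(1)]
    show "u \<in> B \<and> w \<in> B \<and> (w, u) \<notin> (\<lambda>(x, y). (p x, p y)) ` R"
      unfolding xy(2,3) eq[OF R(2,1)] using R by (simp add: B)
  next
    fix u w assume "u \<in> B" "w \<in> B" "u \<noteq> w"
    then obtain x y where xy: "x \<in> A" "y \<in> A" "u = p x" "w = p y" "x \<noteq> y" unfolding B by blast
    show "(u, w) \<in> (\<lambda>(x, y). (p x, p y)) ` R \<or> (w, u) \<in> (\<lambda>(x, y). (p x, p y)) ` R"
      unfolding xy(3,4) eq[OF xy(1,2)] eq[OF xy(2,1)] using tournament_total[OF assms(1) xy(1,2,5)] by blast
  qed
qed

definition inv_sign :: "nat \<Rightarrow> nat \<Rightarrow> int" where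
  "inv_sign a b = (if b < a then -1 else 1)"

lemma inv_sign_swap: "a \<noteq> b \<Longrightarrow> inv_sign b a = - inv_sign a b"
  by (auto simp: inv_sign_def)

lemma inv_sign_mult_swap:
  "a \<noteq> b \<Longrightarrow> c \<noteq> d \<Longrightarrow> inv_sign a b * inv_sign c d = inv_sign b a * inv_sign d c"
  by (simp add: inv_sign_swap[of b a] inv_sign_swap[of d c])

lemma inv_sign_square [simp]: "inv_sign a b * inv_sign a b = 1"
  by (auto simp: inv_sign_def)

lemma inv_sign_less [simp]: "a < b \<Longrightarrow> inv_sign a b = 1"
  by (auto simp: inv_sign_def)

lemma prod_inv_sign_square:
  "(\<Prod>(x, y)\<in>R. inv_sign (t x) (t y)) * (\<Prod>(x, y)\<in>R. inv_sign (t x) (t y)) = 1"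
  by (simp add: prod.distrib[symmetric] split_def)

lemma prod_inv_sign_transpose:
  assumes "a < k" and "b < k" and "a \<noteq> b"
  shows "(\<Prod>(x, y)\<in>{(i, j). i < j \<and> j < k}.
    inv_sign (Transposition.transpose a b x) (Transposition.transpose a b y) * inv_sign x y) = -1"
proof -
  let ?\<tau> = "Transposition.transpose a b"
  let ?g = "\<lambda>x y. inv_sign (?\<tau> x) (?\<tau> y) * inv_sign x y"
  let ?Z = "{..<k} - {a, b}"
  let ?R1 = "{(i, j). i < j \<and> i \<in> ?Z \<and> j \<in> ?Z}"
  (* Pairs {a, z} and {b, z} contribute equal signs, pairs that avoid a and b contribute 1. *)
  let ?R = "insert (a, b) (Pair a ` ?Z \<union> (Pair b ` ?Z \<union> ?R1))"
  have fin: "finite ?R1" by (rule finite_subset[of _ "{..<k} \<times> {..<k}"]) auto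
  have "(\<Prod>(x, y)\<in>{(i, j). i < j \<and> j < k}. ?g x y) = (\<Prod>(x, y)\<in>?R. ?g x y)"
  proof (rule prod_tournament_eq[OF tournament_less])
    show "tournament {..<k} ?R"
      by (rule tournamentI) (use assms in auto)
    show "?g x y = ?g y x" if "x \<noteq> y" for x y
    proof (rule inv_sign_mult_swap[OF _ that])
      show "?\<tau> x \<noteq> ?\<tau> y" using that by (metis transpose_involutory)
    qed
  qed
  also have "\<dots> = ?g a b * (\<Prod>(x, y)\<in>Pair a ` ?Z \<union> (Pair b ` ?Z \<union> ?R1). ?g x y)"
    by (subst prod.insert) (use assms fin in auto)
  also have "(\<Prod>(x, y)\<in>Pair a ` ?Z \<union> (Pair b ` ?Z \<union> ?R1). ?g x y)
      = (\<Prod>(x, y)\<in>Pair a ` ?Z. ?g x y) * (\<Prod>(x, y)\<in>Pair b ` ?Z \<union> ?R1. ?g x y)"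
    by (rule prod.union_disjoint) (use assms fin in auto)
  also have "(\<Prod>(x, y)\<in>Pair b ` ?Z \<union> ?R1. ?g x y)
      = (\<Prod>(x, y)\<in>Pair b ` ?Z. ?g x y) * (\<Prod>(x, y)\<in>?R1. ?g x y)"
    by (rule prod.union_disjoint) (use assms fin in auto)
  also have "(\<Prod>(x, y)\<in>?R1. ?g x y) = 1"
    by (rule prod.neutral) (auto simp: transpose_def)
  also have "(\<Prod>(x, y)\<in>Pair a ` ?Z. ?g x y) = (\<Prod>z\<in>?Z. ?g a z)"
    by (subst prod.reindex) (auto simp: inj_on_def)
  also have "(\<Prod>(x, y)\<in>Pair b ` ?Z. ?g x y) = (\<Prod>z\<in>?Z. ?g b z)"
    by (subst prod.reindex) (auto simp: inj_on_def)
  also have "(\<Prod>z\<in>?Z. ?g a z) = (\<Prod>z\<in>?Z. ?g b z)"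
    by (rule prod.cong) (auto simp: transpose_def mult.commute)
  also have "?g a b = -1"
    using assms inv_sign_swap[of a b] by simp
  finally show ?thesis
    by (simp add: prod.distrib[symmetric] mult.assoc mult.left_commute[of "inv_sign _ _"])
qed

text \<open>
  The product of the inversion signs of \<open>\<tau> \<circ> p\<close> and \<open>p\<close> is symmetric on each pair of values of
  \<open>p\<close>, so it can be evaluated over the increasing pairs of values, where it is the
  inversion sign of the transposition \<open>\<tau>\<close>. Thus the inversion sign changes exactly as \<open>sign\<close> does
  under composition with a transposition.
\<close>

lemma sign_eq_prod_inv_sign:
  assumes "p permutes {..<k}"
  shows "sign p = (\<Prod>(i, j)\<in>{(i, j). i < j \<and> j < k}. inv_sign (p i) (p j))"
  using assms finite_lessThan
proof (induction rule: permutes_induct)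
  case id
  have "(\<Prod>(i, j)\<in>{(i, j). i < j \<and> j < k}. inv_sign i j) = 1"
    by (rule prod.neutral) auto
  then show ?case by simp
next
  case (swap a b p)
  let ?\<tau> = "Transposition.transpose a b"
  let ?R = "{(i, j). i < j \<and> j < k}"
  let ?g = "\<lambda>x y. inv_sign (?\<tau> x) (?\<tau> y) * inv_sign x y"
  let ?pp = "\<lambda>(x, y). (p x, p y)"
  have inj: "inj p" using swap.hyps by (simp add: permutes_inj)
  let ?S = "\<Prod>(i, j)\<in>?R. inv_sign ((?\<tau> \<circ> p) i) ((?\<tau> \<circ> p) j)"
  have "?S * (\<Prod>(i, j)\<in>?R. inv_sign (p i) (p j))
      = (\<Prod>(i, j)\<in>?R. ?g (p i) (p j))"
    by (simp add: prod.distrib[symmetric] split_def)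
  also have "\<dots> = (\<Prod>(x, y)\<in>?pp ` ?R. ?g x y)"
  proof -
    have "inj_on ?pp ?R" using inj by (auto intro!: inj_onI dest: injD)
    then show ?thesis by (simp add: prod.reindex split_def)
  qed
  also have "\<dots> = (\<Prod>(x, y)\<in>?R. ?g x y)"
  proof (rule prod_tournament_eq)
    show "tournament {..<k} (?pp ` ?R)"
      using tournament_image[OF tournament_less] permutes_imp_bij[OF swap.hyps(4)] by blast
    show "?g x y = ?g y x" if "x \<noteq> y" for x y
    proof (rule inv_sign_mult_swap[OF _ that])
      show "?\<tau> x \<noteq> ?\<tau> y" using that by (metis transpose_involutory)
    qed
  qed (rule tournament_less)
  also have "\<dots> = -1"
    using swap.hyps by (intro prod_inv_sign_transpose) auto
  finally have S: "?S * sign p = -1"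
    using swap.IH by simp
  have "permutation p"
    using swap.hyps(4) by (auto simp: permutation_permutes)
  then have "sign (?\<tau> \<circ> p) = - sign p"
    using swap.hyps(3) by (simp add: sign_compose permutation_swap_id sign_swap_id)
  also have "\<dots> = ?S * sign p * sign p" using S by simp
  also have "\<dots> = ?S" by (simp only: mult.assoc sign_idempotent mult_1_right)
  finally show ?case .
qed

lemma tournament_revlex:
  assumes "\<And>e. e \<in> H \<Longrightarrow> finite e"
  shows "tournament H {(e, f). e \<in> H \<and> f \<in> H \<and> revlex_less e f}"
proof -
  have one: "(revlex_less e f \<or> revlex_less f e) \<and> \<not> (revlex_less e f \<and> revlex_less f e)"
    if ef: "e \<in> H" "f \<in> H" "e \<noteq> f" for e f
  proof -
    let ?D = "(e - f) \<union> (f - e)"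
    have "?D \<noteq> {}" using ef(3) by blast
    then have "Max ?D \<in> ?D"
      using assms ef by (intro Max_in) auto
    moreover have "(f - e) \<union> (e - f) = ?D" by (rule Un_commute)
    ultimately show ?thesis
      using ef(3) unfolding revlex_less_def by (metis DiffE UnE)
  qed
  have neq: "e \<noteq> f" if "revlex_less e f" for e f
    using that by (simp add: revlex_less_def)
  show ?thesis
  proof (rule tournamentI)
    fix e f assume "(e, f) \<in> {(e, f). e \<in> H \<and> f \<in> H \<and> revlex_less e f}"
    then have "e \<in> H" "f \<in> H" "revlex_less e f" by auto
    then show "e \<in> H \<and> f \<in> H \<and> (f, e) \<notin> {(e, f). e \<in> H \<and> f \<in> H \<and> revlex_less e f}"
      using one[of e f] neq[of e f] by simp
  next
    fix e f assume "e \<in> H" "f \<in> H" "e \<noteq> f"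
    then show "(e, f) \<in> {(e, f). e \<in> H \<and> f \<in> H \<and> revlex_less e f}
        \<or> (f, e) \<in> {(e, f). e \<in> H \<and> f \<in> H \<and> revlex_less e f}"
      using one[of e f] by simp
  qed
qed

lemma power_card_inversions:
  assumes "finite H"
  shows "(-1) ^ card (inversions H t)
    = (\<Prod>(e, f)\<in>{(e, f). e \<in> H \<and> f \<in> H \<and> revlex_less e f}. inv_sign (t e) (t f))"
    (is "_ = (\<Prod>(e, f)\<in>?R. _)")
proof -
  have fin: "finite ?R" by (rule finite_subset[of _ "H \<times> H"]) (use assms in auto)
  have inv: "inversions H t = {x \<in> ?R. t (snd x) < t (fst x)}"
    unfolding inversions_def by auto
  have "(\<Prod>(e, f)\<in>?R. inv_sign (t e) (t f)) = (\<Prod>x\<in>?R. if t (snd x) < t (fst x) then - 1 else 1)"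
    by (simp add: inv_sign_def split_def)
  also have "\<dots> = (\<Prod>x\<in>inversions H t. - 1)"
    unfolding inv by (rule prod.inter_filter[symmetric]) (rule fin)
  finally show ?thesis by simp
qed

text \<open>
  This is the Leibniz formula, reindexed from permutations of positions to bijections \<open>t\<close> from
  row labels to column labels. The factor between the sign of \<open>t\<close> and the sign of the permutation
  compares the reverse lexicographic order with the order of \<open>hs\<close> only.
\<close>

lemma sum_inversions_ldet:
  fixes N :: "nat set \<Rightarrow> nat \<Rightarrow> 'k::field"
  assumes "distinct hs" and "\<And>e. e \<in> set hs \<Longrightarrow> finite e"
    and "sorted ts" and "distinct ts" and len: "length ts = length hs"
  shows "(\<Sum>t\<in>{t \<in> set hs \<rightarrow>\<^sub>E set ts. inj_on t (set hs)}.
      of_int ((-1) ^ card (inversions (set hs) t)) * (\<Prod>e\<in>set hs. N e (t e))) \<simeq> ldet N hs ts"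
proof -
  define k where "k = length hs"
  have lent: "length ts = k" using len by (simp add: k_def)
  have bh: "bij_betw ((!) hs) {..<k} (set hs)" and bt: "bij_betw ((!) ts) {..<k} (set ts)"
    using assms(1,4) by (auto simp: k_def len intro: bij_betw_nth)
  define idx where "idx = the_inv_into {..<k} ((!) hs)"
  define pos where "pos = the_inv_into {..<k} ((!) ts)"
  have bidx: "bij_betw idx (set hs) {..<k}" and bpos: "bij_betw pos (set ts) {..<k}"
    unfolding idx_def pos_def using bh bt by (auto intro: bij_betw_the_inv_into)
  have idx: "idx (hs ! i) = i" and pos: "pos (ts ! i) = i" if "i < k" for i
    using that bh bt by (auto simp: idx_def pos_def bij_betw_def intro!: the_inv_into_f_f)
  have hs_idx: "hs ! idx e = e" "idx e < k" if "e \<in> set hs" for e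
    using that bh bidx by (auto simp: idx_def bij_betw_def f_the_inv_into_f)
  have ts_pos: "ts ! pos e = e" "pos e < k" if "e \<in> set ts" for e
    using that bt bpos by (auto simp: pos_def bij_betw_def f_the_inv_into_f)
  have ts_less: "ts ! i < ts ! j \<longleftrightarrow> i < j" if "i < k" "j < k" for i j
  proof -
    have mono: "ts ! a < ts ! b" if "a < b" "b < k" for a b
      using that assms(3,4) lent sorted_wrt_nth_less[of "(<)" ts a b] by (simp add: strict_sorted_iff)
    show ?thesis using mono[of i j] mono[of j i] that by (cases i j rule: linorder_cases) auto
  qed
  let ?T = "{t \<in> set hs \<rightarrow>\<^sub>E set ts. inj_on t (set hs)}"
  let ?P = "{p. p permutes {0..<k}}"
  define tp where "tp p = restrict (\<lambda>e. ts ! p (idx e)) (set hs)" for p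
  define pt where "pt t i = (if i < k then pos (t (hs ! i)) else i)" for t i
  have perm_lt: "p i < k" if "p \<in> ?P" "i < k" for p i
    using that permutes_in_image[of p "{0..<k}" i] by auto
  have tp_T: "tp p \<in> ?T" if p: "p \<in> ?P" for p
  proof -
    have "inj_on (\<lambda>e. ts ! p (idx e)) (set hs)"
    proof (rule inj_onI)
      fix e f assume ef: "e \<in> set hs" "f \<in> set hs" "ts ! p (idx e) = ts ! p (idx f)"
      then have "p (idx e) = p (idx f)"
        using perm_lt[OF p] hs_idx by (metis pos)
      then have "idx e = idx f"
        using p permutes_inj by (auto dest: injD)
      then show "e = f" using ef hs_idx by metis
    qed
    moreover have "ts ! p (idx e) \<in> set ts" if "e \<in> set hs" for e
      using perm_lt[OF p] hs_idx(2)[OF that] lent by (metis nth_mem)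
    ultimately show ?thesis by (auto simp: tp_def inj_on_def)
  qed
  have pt_P: "pt t \<in> ?P" if t: "t \<in> ?T" for t
  proof -
    have "t ` set hs = set ts"
      using t card_image[of t "set hs"] assms(1,4) len
      by (intro card_subset_eq) (auto simp: distinct_card)
    then have "bij_betw t (set hs) (set ts)" using t by (simp add: bij_betw_def)
    then have "bij_betw (pos \<circ> (t \<circ> (!) hs)) {..<k} {..<k}"
      using bh bpos by (intro bij_betw_trans)
    then have "bij_betw (pt t) {..<k} {..<k}"
      by (rule iffD1[OF bij_betw_cong, rotated]) (auto simp: pt_def)
    then have "pt t permutes {..<k}"
      by (rule bij_imp_permutes) (simp add: pt_def)
    then show ?thesis by (simp add: atLeast0LessThan)
  qed
  have pt_tp: "pt (tp p) = p" if p: "p \<in> ?P" for p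
  proof
    fix i show "pt (tp p) i = p i"
    proof (cases "i < k")
      case True
      then have "hs ! i \<in> set hs" by (simp add: k_def)
      then show ?thesis using True perm_lt[OF p True] by (simp add: pt_def tp_def idx pos)
    next
      case False
      then show ?thesis using p permutes_not_in[of p "{0..<k}" i] by (simp add: pt_def)
    qed
  qed
  have tp_pt: "tp (pt t) = t" if t: "t \<in> ?T" for t
  proof
    fix e show "tp (pt t) e = t e"
    proof (cases "e \<in> set hs")
      case True
      then have "t e \<in> set ts" using t by auto
      then show ?thesis using True by (simp add: tp_def pt_def hs_idx ts_pos)
    next
      case False
      then show ?thesis using t by (auto simp: tp_def PiE_def extensional_def)
    qed
  qed
  let ?R = "{(e, f). e \<in> set hs \<and> f \<in> set hs \<and> revlex_less e f}"
  let ?L = "{(i, j). i < j \<and> j < k}"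
  let ?hh = "\<lambda>(i, j). (hs ! i, hs ! j)"
  (* The global sign that compares the reverse lexicographic order with the order of hs. *)
  define \<epsilon> where "\<epsilon> = (\<Prod>(e, f)\<in>?R. inv_sign (idx e) (idx f))"
  have sgn: "(-1) ^ card (inversions (set hs) (tp p)) = \<epsilon> * sign p" if p: "p \<in> ?P" for p
  proof -
    let ?t = "tp p"
    let ?g = "\<lambda>e f. inv_sign (?t e) (?t f) * inv_sign (idx e) (idx f)"
    have "(-1) ^ card (inversions (set hs) ?t) * \<epsilon> = (\<Prod>(e, f)\<in>?R. ?g e f)"
      by (simp add: power_card_inversions \<epsilon>_def prod.distrib[symmetric] split_def)
    also have "\<dots> = (\<Prod>(e, f)\<in>?hh ` ?L. ?g e f)"
    proof (rule prod_tournament_eq)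
      show "tournament (set hs) ?R" by (rule tournament_revlex) (rule assms(2))
      show "tournament (set hs) (?hh ` ?L)" by (rule tournament_image[OF tournament_less bh])
      show "?g e f = ?g f e" if "e \<in> set hs" "f \<in> set hs" "e \<noteq> f" for e f
      proof -
        have "?t e \<noteq> ?t f" using tp_T[OF p] that by (auto dest: inj_onD)
        moreover have "idx e \<noteq> idx f" using that hs_idx by metis
        ultimately show ?thesis by (rule inv_sign_mult_swap)
      qed
    qed
    also have "\<dots> = (\<Prod>(i, j)\<in>?L. ?g (hs ! i) (hs ! j))"
    proof -
      have "inj_on ?hh ?L"
        using assms(1) by (auto intro!: inj_onI simp: k_def nth_eq_iff_index_eq)
      then show ?thesis by (simp add: prod.reindex split_def)
    qed
    also have "\<dots> = (\<Prod>(i, j)\<in>?L. inv_sign (p i) (p j))"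
    proof (rule prod.cong[OF refl], clarify)
      fix i j assume ij: "i < j" "j < k"
      then have "ts ! p j < ts ! p i \<longleftrightarrow> p j < p i"
        using ts_less[of "p j" "p i"] perm_lt[OF p] by simp
      then have "inv_sign (ts ! p i) (ts ! p j) = inv_sign (p i) (p j)"
        by (simp add: inv_sign_def)
      then show "?g (hs ! i) (hs ! j) = inv_sign (p i) (p j)"
        using ij idx[of i] idx[of j] by (simp add: tp_def k_def)
    qed
    also have "\<dots> = sign p"
      using p by (simp add: sign_eq_prod_inv_sign atLeast0LessThan)
    finally have "(-1) ^ card (inversions (set hs) ?t) * (\<epsilon> * \<epsilon>) = \<epsilon> * sign p"
      by (simp add: algebra_simps)
    then show ?thesis by (simp add: \<epsilon>_def prod_inv_sign_square)
  qed
  have "(\<Sum>t\<in>?T. of_int ((-1) ^ card (inversions (set hs) t)) * (\<Prod>e\<in>set hs. N e (t e)))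
      = (\<Sum>p\<in>?P. of_int (\<epsilon> * sign p) * (\<Prod>i = 0..<k. N (hs ! i) (ts ! p i)))"
  proof (rule sum.reindex_bij_witness[where i = tp and j = pt])
    fix t assume t: "t \<in> ?T"
    have "(\<Prod>e\<in>set hs. N e (t e)) = (\<Prod>i\<in>{..<k}. N (hs ! i) (t (hs ! i)))"
      using prod.reindex_bij_betw[OF bh, of "\<lambda>e. N e (t e)"] by simp
    also have "\<dots> = (\<Prod>i = 0..<k. N (hs ! i) (ts ! pt t i))"
    proof (rule prod.cong)
      fix i assume "i \<in> {0..<k}"
      then have "i < k" and "t (hs ! i) \<in> set ts" using t by (auto simp: k_def)
      then show "N (hs ! i) (t (hs ! i)) = N (hs ! i) (ts ! pt t i)"
        by (simp add: pt_def ts_pos)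
    qed auto
    finally show "of_int (\<epsilon> * sign (pt t)) * (\<Prod>i = 0..<k. N (hs ! i) (ts ! pt t i))
        = of_int ((-1) ^ card (inversions (set hs) t)) * (\<Prod>e\<in>set hs. N e (t e))"
      using sgn[OF pt_P[OF t]] tp_pt[OF t] by simp
  qed (use tp_T pt_P tp_pt pt_tp in auto)
  also have "\<dots> = of_int \<epsilon> * (\<Sum>p\<in>?P. signof p * (\<Prod>i = 0..<k. N (hs ! i) (ts ! p i)))"
    by (simp add: sum_distrib_left mult.assoc)
  also have "(\<Sum>p\<in>?P. signof p * (\<Prod>i = 0..<k. N (hs ! i) (ts ! p i))) = ldet N hs ts"
    unfolding ldet_def k_def[symmetric]
    by (subst det_def'[of _ k]) (auto intro!: sum.cong prod.cong simp: permutes_in_image)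
  also have "of_int \<epsilon> * ldet N hs ts \<simeq> ldet N hs ts"
  proof (rule up_to_sign_unit_mult)
    have "\<epsilon> * \<epsilon> = 1" unfolding \<epsilon>_def by (rule prod_inv_sign_square)
    then show "of_int \<epsilon> * of_int \<epsilon> = (1 :: 'k)" by (metis of_int_1 of_int_mult)
  qed
  finally show ?thesis .
qed

lemma ldet_singleton [simp]: "ldet M [h] [t] = M h t"
  unfolding ldet_def by (subst det_single) auto

lemma prod_list_sign_square: "(\<Prod>t\<leftarrow>ts. (-1) ^ f t) * (\<Prod>t\<leftarrow>ts. (-1) ^ f t) = (1 :: 'k::field)"
proof (induction ts)
  case (Cons t ts)
  have "((-1) ^ f t * (-1) ^ f t :: 'k) = 1" by (simp flip: power_add)
  then show ?case using Cons by (simp add: algebra_simps)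
qed simp

text \<open>
  When \<open>q\<close> are the Pluecker coordinates of \<open>X\<close>, these are the entries of the vector of \<open>X\<close> supported
  on \<open>e\<close> that \<open>e\<close>, a set of \<open>n - d\<close> coordinates, determines up to scaling (the vector is zero if \<open>X\<close>
  meets the coordinate subspace of \<open>e\<close> in more than a line).
\<close>

definition circuit_entry :: "nat \<Rightarrow> (nat set \<Rightarrow> 'k::field) \<Rightarrow> nat set \<Rightarrow> nat \<Rightarrow> 'k" where
  "circuit_entry n q e i = (if i \<in> e
     then (-1) ^ card (({1..n} - e) \<inter> {..<i}) * q ({1..n} - (e - {i})) else 0)"

text \<open>
  An orientation with root set \<open>I\<^sub>0\<close> is a perfect matching of the hyperedges with the vertices outside
  \<open>I\<^sub>0\<close>, because there are as many such vertices as hyperedges. The orientation sum is therefore the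
  determinant of a square matrix, in which the missing factor for \<open>e\<^sub>0\<close> makes the row of \<open>e\<^sub>0\<close> a
  signed unit vector: \<open>e\<^sub>0 - I\<^sub>0\<close> has a single element, the only possible target of \<open>e\<^sub>0\<close>. Expanding
  along this row leaves a determinant in which \<open>I\<^sub>0\<close> no longer occurs. This is why
  the choice of \<open>I\<^sub>0\<close> does not matter.
\<close>

lemma orientation_sum_eq_ldet:
  fixes q :: "nat set \<Rightarrow> 'k::field"
  assumes H: "H \<subseteq> nsets {1..n} m" "finite H" and e0: "e\<^sub>0 \<in> H"
    and I0: "I\<^sub>0 \<subset> e\<^sub>0" "card I\<^sub>0 = m - 1"
    and V: "card (\<Union>H) = m - 1 + card H"
    and hs: "distinct hs" "set hs = H - {e\<^sub>0}" and ts: "distinct ts" "set ts = \<Union>H - e\<^sub>0"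
  shows "orientation_sum n q H e\<^sub>0 I\<^sub>0 \<simeq> ldet (circuit_entry n q) hs ts"
proof -
  have e: "e \<subseteq> {1..n}" "finite e" "card e = m" if "e \<in> H" for e
    using H(1) that by (auto simp: nsets_def)
  have finV: "finite (\<Union>H)" using H(2) e by auto
  have finI: "finite I\<^sub>0" using I0(1) e(2)[OF e0] finite_subset by auto
  have "card I\<^sub>0 < m" using psubset_card_mono[OF e(2)[OF e0] I0(1)] e(3)[OF e0] by simp
  then have "card (e\<^sub>0 - I\<^sub>0) = 1"
    using I0 e[OF e0] by (simp add: card_Diff_subset[OF finI])
  then obtain i0 where i0: "e\<^sub>0 - I\<^sub>0 = {i0}" by (auto simp: card_1_singleton_iff)
  define T where "T = \<Union>H - I\<^sub>0"
  have T: "T = insert i0 (\<Union>H - e\<^sub>0)" "i0 \<in> e\<^sub>0" using i0 I0(1) e0 by (auto simp: T_def)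
  have IV: "I\<^sub>0 \<subseteq> \<Union>H" using I0 e0 by auto
  have finT: "finite T" using finV by (simp add: T_def)
  have cardT: "card T = card H"
    using V I0 IV by (simp add: T_def card_Diff_subset[OF finI])
  have len: "length ts = length hs"
  proof -
    have "card T = Suc (card (\<Union>H - e\<^sub>0))"
      unfolding T(1) using T(2) finV by (simp add: card_insert_disjoint)
    moreover have "card H = Suc (card (H - {e\<^sub>0}))"
      using H(2) e0 by (rule card.remove)
    ultimately show ?thesis
      using cardT distinct_card[OF hs(1)] distinct_card[OF ts(1)] hs ts by simp
  qed
  (* The matrix whose Leibniz expansion is the orientation sum. *)
  define N where "N e i = (if i \<in> e then (-1) ^ card ((e - {i}) \<inter> {1..i})
      * (if e = e\<^sub>0 then 1 else q ({1..n} - (e - {i}))) else 0)" for e i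
  let ?O = "{t \<in> orientations H. roots H t = I\<^sub>0}"
  let ?B = "{t \<in> H \<rightarrow>\<^sub>E T. inj_on t H}"
  have "orientation_sum n q H e\<^sub>0 I\<^sub>0
      = (\<Sum>t\<in>?B. of_int ((-1) ^ card (inversions H t)) * (\<Prod>e\<in>H. N e (t e)))"
    unfolding orientation_sum_def
  proof (rule sum.mono_neutral_cong_left)
    show "finite ?B" using finite_PiE[OF H(2), of "\<lambda>_. T"] finT by simp
    show "?O \<subseteq> ?B"
    proof
      fix t assume t: "t \<in> ?O"
      then have "t \<in> (\<Pi>\<^sub>E e\<in>H. e)" "inj_on t H" "roots H t = I\<^sub>0" by (auto simp: orientations_def)
      then show "t \<in> ?B" by (auto simp: roots_def T_def PiE_iff)
    qed
    show "\<forall>t\<in>?B - ?O. of_int ((-1) ^ card (inversions H t)) * (\<Prod>e\<in>H. N e (t e)) = 0"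
    proof
      fix t assume t: "t \<in> ?B - ?O"
      have "\<exists>e\<in>H. t e \<notin> e"
      proof (rule ccontr)
        assume "\<not> (\<exists>e\<in>H. t e \<notin> e)"
        then have te: "t e \<in> e" if "e \<in> H" for e using that by blast
        then have "t \<in> orientations H" using t by (auto simp: orientations_def PiE_iff)
        moreover have "t ` H = T"
          using t cardT card_image[of t H] finT by (intro card_subset_eq) auto
        moreover have "(\<Union>e\<in>H. sources t e) \<union> t ` H = \<Union>H"
          using te by (auto simp: sources_def)
        moreover have "roots H t = ((\<Union>e\<in>H. sources t e) \<union> t ` H) - t ` H"
          by (simp add: roots_def Un_Diff)
        ultimately have "roots H t = I\<^sub>0"
          using IV by (simp add: T_def double_diff)
        with \<open>t \<in> orientations H\<close> t show False by simp
      qed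
      then obtain e where "e \<in> H" "N e (t e) = 0" by (auto simp: N_def)
      then have "(\<Prod>e\<in>H. N e (t e)) = 0" using H(2) by (auto intro: prod_zero)
      then show "of_int ((-1) ^ card (inversions H t)) * (\<Prod>e\<in>H. N e (t e)) = 0" by simp
    qed
    fix t assume "t \<in> ?O"
    then have te: "t e \<in> e" if "e \<in> H" for e using that by (auto simp: orientations_def)
    have "(\<Prod>e\<in>H. N e (t e)) = (\<Prod>e\<in>H. (-1) ^ card (sources t e \<inter> {1..t e})
        * (if e = e\<^sub>0 then 1 else q ({1..n} - sources t e)))"
      by (rule prod.cong) (use te in \<open>auto simp: N_def sources_def\<close>)
    also have "\<dots> = (-1) ^ (\<Sum>e\<in>H. card (sources t e \<inter> {1..t e}))
        * (\<Prod>e\<in>H. if e = e\<^sub>0 then 1 else q ({1..n} - sources t e))"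
      by (simp add: prod.distrib power_sum)
    also have "(\<Prod>e\<in>H. if e = e\<^sub>0 then 1 else q ({1..n} - sources t e))
        = (\<Prod>e\<in>H - {e\<^sub>0}. q ({1..n} - sources t e))"
      by (subst prod.remove[OF H(2) e0]) (auto intro: prod.cong)
    finally show "of_int (orientation_sign H t) * (\<Prod>e\<in>H - {e\<^sub>0}. q ({1..n} - sources t e))
        = of_int ((-1) ^ card (inversions H t)) * (\<Prod>e\<in>H. N e (t e))"
      by (simp add: orientation_sign_def)
  qed
  also have "\<dots> \<simeq> ldet N (e\<^sub>0 # hs) (sorted_list_of_set T)"
  proof -
    have set: "set (e\<^sub>0 # hs) = H" using hs e0 by auto
    have dist: "distinct (e\<^sub>0 # hs)" using hs by simp
    have "length (sorted_list_of_set T) = length (e\<^sub>0 # hs)"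
      using distinct_card[OF dist] set cardT by simp
    then show ?thesis
      using sum_inversions_ldet[OF dist, of "sorted_list_of_set T" N] e(2) finT unfolding set by simp
  qed
  also have "\<dots> \<simeq> ldet N ([e\<^sub>0] @ hs) ([i0] @ ts)"
  proof (rule ldet_reorder)
    have "distinct ([i0] @ ts)" "set ([i0] @ ts) = T" using ts T by auto
    then show "mset (sorted_list_of_set T) = mset ([i0] @ ts)"
      using finT by (metis mset_set_set mset_sorted_list_of_multiset sorted_list_of_mset_set)
    show "length (sorted_list_of_set T) = length (e\<^sub>0 # hs)"
      using distinct_card[of "e\<^sub>0 # hs"] hs e0 cardT by (simp add: insert_absorb)
  qed simp
  also have "\<dots> = ldet N [e\<^sub>0] [i0] * ldet N hs ts"
  proof (rule ldet_block)
    show "N h t = 0" if "h \<in> set [e\<^sub>0]" "t \<in> set ts" for h t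
      using that ts by (auto simp: N_def)
  qed (simp_all add: len)
  also have "\<dots> \<simeq> ldet N hs ts"
    by (rule up_to_sign_unit_mult) (use T in \<open>simp add: N_def flip: power_add\<close>)
  (* The i - 1 vertices below a target i of e are split by membership in e. *)
  also have "ldet N hs ts = ldet (\<lambda>e i. (-1) ^ (i - 1) * circuit_entry n q e i) hs ts"
  proof (rule ldet_cong)
    show "N e i = (-1) ^ (i - 1) * circuit_entry n q e i" if "e \<in> set hs" for e i
    proof (cases "i \<in> e")
      case True
      have eH: "e \<in> H" "e \<noteq> e\<^sub>0" using that hs by auto
      have "{1..<i} = (e - {i}) \<inter> {1..i} \<union> ({1..n} - e) \<inter> {..<i}"
        using e(1)[OF eH(1)] True by auto
      then have "card {1..<i} = card ((e - {i}) \<inter> {1..i}) + card (({1..n} - e) \<inter> {..<i})"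
        using e(2)[OF eH(1)] by (subst card_Un_disjoint[symmetric]) auto
      then have i: "i - 1 = card ((e - {i}) \<inter> {1..i}) + card (({1..n} - e) \<inter> {..<i})"
        by simp
      have "(-1) ^ (i - 1) * (-1) ^ card (({1..n} - e) \<inter> {..<i})
          = (-1 :: 'k) ^ card ((e - {i}) \<inter> {1..i})"
        unfolding i by (simp add: power_add flip: power_mult_distrib)
      then show ?thesis
        using True eH by (simp add: N_def circuit_entry_def flip: mult.assoc)
    qed (simp add: N_def circuit_entry_def)
  qed (rule len)
  also have "\<dots> = (\<Prod>i\<leftarrow>ts. (-1) ^ (i - 1)) * ldet (circuit_entry n q) hs ts"
    by (rule ldet_scale_columns) (rule len)
  also have "\<dots> \<simeq> ldet (circuit_entry n q) hs ts"
    by (rule up_to_sign_unit_mult) (rule prod_list_sign_square)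
  finally show ?thesis .
qed

section \<open>Nonzero maximal minors\<close>

lemma det_bordered_column_ldet:
  "length cs = d \<Longrightarrow> ldet b [0..<Suc d] (i # cs)
     = (\<Sum>r<Suc d. b r i * signed_minor d (\<lambda>r j. b r (cs ! j)) r)"
  unfolding det_bordered_column[symmetric] ldet_def
  by (intro arg_cong[of _ _ det] eq_matI) (auto simp: nth_Cons' simp del: upt_Suc)

text \<open>
  Induction on the number of rows. Bordering a nonzero minor of all rows but one by a
  variable column \<open>i\<close> gives, as a function of \<open>i\<close>, a linear combination of the rows whose
  coefficient at the remaining row is that minor up to sign. By independence it is nonzero for some \<open>i\<close>.
\<close>

lemma nonzero_maximal_minor:
  fixes b :: "nat \<Rightarrow> 'i \<Rightarrow> 'k::field"
  assumes "\<And>g. (\<And>i. i \<in> E \<Longrightarrow> (\<Sum>r<k. g r * b r i) = 0) \<Longrightarrow> \<forall>r<k. g r = 0"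
  shows "\<exists>cs. length cs = k \<and> set cs \<subseteq> E \<and> ldet b [0..<k] cs \<noteq> 0"
  using assms
proof (induction k)
  case 0
  have "ldet b [0..<0] [] = 1" unfolding ldet_def by (rule det_dim_zero) auto
  then show ?case by (intro exI[of _ "[]"]) auto
next
  case (Suc k)
  have "\<exists>cs. length cs = k \<and> set cs \<subseteq> E \<and> ldet b [0..<k] cs \<noteq> 0"
  proof (rule Suc.IH)
    fix g assume g: "\<And>i. i \<in> E \<Longrightarrow> (\<Sum>r<k. g r * b r i) = 0"
    have "(\<Sum>r<Suc k. (if r < k then g r else 0) * b r i) = 0" if "i \<in> E" for i
      using g[OF that] by simp
    then have "\<forall>r<Suc k. (if r < k then g r else 0) = 0"
      using Suc.prems[of "\<lambda>r. if r < k then g r else 0"] by blast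
    then show "\<forall>r<k. g r = 0" by (metis less_Suc_eq)
  qed
  then obtain cs where cs: "length cs = k" "set cs \<subseteq> E" "ldet b [0..<k] cs \<noteq> 0" by blast
  let ?g = "signed_minor k (\<lambda>r j. b r (cs ! j))"
  have "det (mat k k (\<lambda>(i, j). b (insert_index k i) (cs ! j))) = ldet b [0..<k] cs"
    unfolding ldet_def by (intro arg_cong[of _ _ det] eq_matI) (auto simp: insert_index_def)
  then have "?g k \<noteq> 0" using cs(3) by (simp add: signed_minor_def)
  then obtain i where i: "i \<in> E" "(\<Sum>r<Suc k. ?g r * b r i) \<noteq> 0"
    using Suc.prems[of ?g] by blast
  have "ldet b [0..<Suc k] (i # cs) \<noteq> 0"
    using i(2) unfolding det_bordered_column_ldet[OF cs(1)]
    by (simp add: mult.commute del: sum.lessThan_Suc)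
  then show ?case using i(1) cs by (intro exI[of _ "i # cs"]) auto
qed

lemma distinct_of_ldet_nonzero:
  assumes "ldet M hs ts \<noteq> 0" and len: "length ts = length hs"
  shows "distinct ts"
proof (rule ccontr)
  assume "\<not> distinct ts"
  then obtain i j where ij: "i < length ts" "j < length ts" "i \<noteq> j" "ts ! i = ts ! j"
    by (auto simp: distinct_conv_nth)
  let ?A = "mat (length hs) (length hs) (\<lambda>(i, j). M (hs ! i) (ts ! j))"
  have "det ?A = 0"
    by (rule det_identical_columns[of _ "length hs" i j])
       (use ij len in \<open>auto intro!: eq_vecI\<close>)
  then show False using assms(1) by (simp add: ldet_def)
qed

section \<open>The circuit vectors of a linear space\<close>

definition elements_list :: "nat \<Rightarrow> nat set \<Rightarrow> nat list" where
  "elements_list n J = filter (\<lambda>e. e \<in> J) [1..<Suc n]"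

lemma set_elements_list: "J \<subseteq> {1..n} \<Longrightarrow> set (elements_list n J) = J"
  by (auto simp: elements_list_def)

lemma distinct_elements_list [simp]: "distinct (elements_list n J)"
  by (simp add: elements_list_def)

lemma length_elements_list: "J \<subseteq> {1..n} \<Longrightarrow> length (elements_list n J) = card J"
  using distinct_card[OF distinct_elements_list] set_elements_list by metis

lemma elements_list_insert:
  assumes "i \<in> {1..n}" and "i \<notin> J" and "J \<subseteq> {1..n}"
  obtains xs ys where "elements_list n (insert i J) = xs @ i # ys" and "elements_list n J = xs @ ys"
    and "length xs = card (J \<inter> {..<i})"
proof
  let ?xs = "filter (\<lambda>e. e \<in> J) [1..<i]" and ?ys = "filter (\<lambda>e. e \<in> J) [Suc i..<Suc n]"
  have "[1..<Suc n] = [1..<i] @ [i..<Suc n]"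
    using upt_add_eq_append[of 1 i "Suc n - i"] assms(1) by (simp del: upt_Suc)
  moreover have "[i..<Suc n] = i # [Suc i..<Suc n]"
    using assms(1) by (intro upt_conv_Cons) auto
  ultimately have split: "[1..<Suc n] = [1..<i] @ i # [Suc i..<Suc n]" by simp
  have 1: "filter (\<lambda>e. e \<in> insert i J) [1..<i] = ?xs"
    by (rule filter_cong) auto
  have 2: "filter (\<lambda>e. e \<in> insert i J) [Suc i..<Suc n] = ?ys"
    by (rule filter_cong) (auto simp del: upt_Suc)
  show "elements_list n (insert i J) = ?xs @ i # ?ys"
    unfolding elements_list_def split filter_append 1 using 2 by simp
  show "elements_list n J = ?xs @ ?ys"
    unfolding elements_list_def split using assms(2) by simp
  have "set ?xs = J \<inter> {..<i}" using assms(3) by auto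
  then show "length ?xs = card (J \<inter> {..<i})"
    using distinct_card[of ?xs] by simp
qed

text \<open>
  As a linear form on \<open>K ^ (d + 1)\<close> this vector sends \<open>x\<close> to the determinant whose columns are \<open>x\<close>
  and the columns of \<open>A\<close> in \<open>J\<close>. As coefficients of a combination of the rows of \<open>A\<close>
  it gives the circuit vector supported outside \<open>J\<close>.
\<close>

definition cofactor_vec :: "(nat \<Rightarrow> nat \<Rightarrow> 'k::field) \<Rightarrow> nat \<Rightarrow> nat \<Rightarrow> nat set \<Rightarrow> nat \<Rightarrow> 'k" where
  "cofactor_vec A n d J = signed_minor d (\<lambda>r j. A r (elements_list n J ! j))"

lemma mat_delete_insert_column:
  assumes "length (xs @ ys) = d" and "r < Suc d"
  shows "mat_delete (mat (Suc d) (Suc d) (\<lambda>(r, c). A r ((xs @ i # ys) ! c))) r (length xs)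
    = mat d d (\<lambda>(i, j). A (insert_index r i) ((xs @ ys) ! j))"
  by (rule eq_matI)
     (use assms in \<open>auto simp: mat_delete_def insert_index_def nth_append nth_Cons' Suc_diff_le\<close>)

lemma cofactor_insert_column:
  assumes "length (xs @ ys) = d" and "r < Suc d"
  shows "cofactor (mat (Suc d) (Suc d) (\<lambda>(r, c). A r ((xs @ i # ys) ! c))) r (length xs)
    = (-1) ^ length xs * signed_minor d (\<lambda>r j. A r ((xs @ ys) ! j)) r"
  unfolding cofactor_def mat_delete_insert_column[OF assms]
  by (simp add: signed_minor_def power_add)

text \<open>
  The sign comes from moving the column \<open>i\<close> to its place in the increasing list of columns.
\<close>

lemma sum_cofactor_vec_column:
  assumes J: "J \<in> nsets {1..n} d" and i: "i \<in> {1..n}"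
  shows "(\<Sum>r<Suc d. cofactor_vec A n d J r * A r i)
    = (if i \<in> J then 0 else (-1) ^ card (J \<inter> {..<i}) * ldet A [0..<Suc d] (elements_list n (insert i J)))"
proof -
  have sub: "J \<subseteq> {1..n}" "card J = d" using J by (auto simp: nsets_def)
  have len: "length (elements_list n J) = d" using length_elements_list sub by metis
  show ?thesis
  proof (cases "i \<in> J")
    case True
    then obtain j where "j < d" "elements_list n J ! j = i"
      using set_elements_list[OF sub(1)] len by (metis in_set_conv_nth)
    then show ?thesis
      using signed_minor_orthogonal[of j d "\<lambda>r j. A r (elements_list n J ! j)"] True
      by (simp add: cofactor_vec_def)
  next
    case False
    obtain xs ys where xy: "elements_list n (insert i J) = xs @ i # ys" "elements_list n J = xs @ ys"
      "length xs = card (J \<inter> {..<i})"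
      using elements_list_insert[OF i False sub(1)] .
    have lxy: "length (xs @ ys) = d" using len xy(2) by simp
    let ?S = "mat (Suc d) (Suc d) (\<lambda>(r, c). A r ((xs @ i # ys) ! c))"
    have "ldet A [0..<Suc d] (xs @ i # ys) = det ?S"
      unfolding ldet_def by (intro arg_cong[of _ _ det] eq_matI) (auto simp del: upt_Suc)
    also have "\<dots> = (\<Sum>r<Suc d. ?S $$ (r, length xs) * cofactor ?S r (length xs))"
      using lxy by (intro laplace_expansion_column) auto
    also have "\<dots> = (\<Sum>r<Suc d. (-1) ^ length xs * (cofactor_vec A n d J r * A r i))"
    proof (rule sum.cong[OF refl])
      fix r assume "r \<in> {..<Suc d}"
      then have r: "r < Suc d" by simp
      have "?S $$ (r, length xs) = A r i" using r lxy by simp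
      then show "?S $$ (r, length xs) * cofactor ?S r (length xs)
          = (-1) ^ length xs * (cofactor_vec A n d J r * A r i)"
        unfolding cofactor_insert_column[OF lxy r] cofactor_vec_def xy(2) by simp
    qed
    also have "\<dots> = (-1) ^ length xs * (\<Sum>r<Suc d. cofactor_vec A n d J r * A r i)"
      by (simp only: sum_distrib_left)
    finally have "ldet A [0..<Suc d] (xs @ i # ys) = (-1) ^ length xs * (\<Sum>r<Suc d. cofactor_vec A n d J r * A r i)" .
    then have "(-1) ^ length xs * ldet A [0..<Suc d] (xs @ i # ys) = (\<Sum>r<Suc d. cofactor_vec A n d J r * A r i)"
      by (simp only: mult.assoc[symmetric]) (simp flip: power_mult_distrib)
    then show ?thesis using False xy by simp
  qed
qed

text \<open>
  Inside \<open>d + 1\<close> columns with nonzero minor, the cofactor vectors of the \<open>d\<close>-subsets are up to sign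
  the rows of an adjugate matrix, which is invertible.
\<close>

lemma cofactor_vec_family_independent:
  fixes A :: "nat \<Rightarrow> nat \<Rightarrow> 'k::field"
  assumes A: "\<And>g. (\<And>i. i \<in> {1..n} \<Longrightarrow> (\<Sum>r<Suc d. g r * A r i) = 0) \<Longrightarrow> \<forall>r<Suc d. g r = 0"
    and g: "\<And>J. J \<in> nsets {1..n} d \<Longrightarrow> (\<Sum>r<Suc d. g r * cofactor_vec A n d J r) = 0"
  shows "\<forall>r<Suc d. g r = 0"
proof -
  obtain cs where cs: "length cs = Suc d" "set cs \<subseteq> {1..n}" "ldet A [0..<Suc d] cs \<noteq> 0"
  proof -
    have "\<exists>cs. length cs = Suc d \<and> set cs \<subseteq> {1..n} \<and> ldet A [0..<Suc d] cs \<noteq> 0"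
      by (rule nonzero_maximal_minor) (rule A)
    then show ?thesis using that by (elim exE conjE)
  qed
  have dist: "distinct cs"
    using distinct_of_ldet_nonzero[OF cs(3)] cs(1) by simp
  define L where "L = elements_list n (set cs)"
  have L: "set L = set cs" "distinct L" "length L = Suc d"
    using set_elements_list[OF cs(2)] length_elements_list[OF cs(2)] distinct_card[OF dist] cs(1)
    by (auto simp: L_def)
  let ?S = "mat (Suc d) (Suc d) (\<lambda>(r, c). A r (L ! c))"
  have S: "?S \<in> carrier_mat (Suc d) (Suc d)" by simp
  have "mset L = mset cs" using L dist by (simp add: set_eq_iff_mset_eq_distinct)
  then have "ldet A [0..<Suc d] L \<simeq> ldet A [0..<Suc d] cs"
    using L by (intro ldet_reorder) auto
  from up_to_sign_0_iff[OF this] have "ldet A [0..<Suc d] L \<noteq> 0" using cs(3) by simp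
  moreover have "ldet A [0..<Suc d] L = det ?S"
    unfolding ldet_def by (intro arg_cong[of _ _ det] eq_matI) (auto simp del: upt_Suc)
  ultimately have det: "det ?S \<noteq> 0" by simp
  have cof: "(\<Sum>r<Suc d. cofactor ?S r p * g r) = 0" if p: "p < Suc d" for p
  proof -
    let ?i = "L ! p" and ?J = "set L - {L ! p}"
    have "?i \<in> set L" using p L(3) by simp
    then have i: "?i \<in> {1..n}" "?J \<subseteq> {1..n}" "insert ?i ?J = set cs"
      using L(1) cs(2) by auto
    have "?i \<notin> ?J" by simp
    then obtain xs ys where "elements_list n (insert ?i ?J) = xs @ ?i # ys"
      and xy2: "elements_list n ?J = xs @ ys" and "length xs = card (?J \<inter> {..<?i})"
      using elements_list_insert[OF i(1) _ i(2)] by blast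
    then have xy: "L = xs @ ?i # ys" "elements_list n ?J = xs @ ys"
      unfolding i(3) L_def[symmetric] by simp_all
    have lxy: "length (xs @ ys) = d" using L(3) xy(1) by (metis add_Suc_right length_Cons length_append nat.inject)
    have "L ! length xs = ?i" using xy(1) by (metis nth_append_length)
    then have px: "length xs = p"
      using L(2,3) p xy(1) lxy nth_eq_iff_index_eq[of L "length xs" p] by simp
    have J: "?J \<in> nsets {1..n} d"
      using i(2) L(2,3) \<open>?i \<in> set L\<close> by (auto simp: nsets_def distinct_card)
    have "cofactor ?S r p = (-1) ^ p * cofactor_vec A n d ?J r" if "r < Suc d" for r
      using cofactor_insert_column[OF lxy that, of A ?i] unfolding xy(1)[symmetric] px cofactor_vec_def xy(2) .
    then have "(\<Sum>r<Suc d. cofactor ?S r p * g r) = (-1) ^ p * (\<Sum>r<Suc d. g r * cofactor_vec A n d ?J r)"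
      unfolding sum_distrib_left by (intro sum.cong) (auto simp del: sum.lessThan_Suc)
    then show ?thesis using g[OF J] by simp
  qed
  define v where "v = vec (Suc d) g"
  have v: "v \<in> carrier_vec (Suc d)" by (simp add: v_def)
  have "adj_mat ?S *\<^sub>v v = 0\<^sub>v (Suc d)"
  proof (rule eq_vecI)
    fix p assume "p < dim_vec (0\<^sub>v (Suc d) :: 'k vec)"
    then have p: "p < Suc d" by simp
    have "(adj_mat ?S *\<^sub>v v) $ p = (\<Sum>r<Suc d. cofactor ?S r p * g r)"
      using p by (simp add: adj_mat_def scalar_prod_def v_def atLeast0LessThan del: sum.lessThan_Suc)
    then show "(adj_mat ?S *\<^sub>v v) $ p = 0\<^sub>v (Suc d) $ p" using cof[OF p] p by simp
  qed (simp add: adj_mat_def)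
  then have "?S *\<^sub>v (adj_mat ?S *\<^sub>v v) = 0\<^sub>v (Suc d)"
    using S by (intro eq_vecI) (simp_all add: scalar_prod_def)
  moreover have "?S *\<^sub>v (adj_mat ?S *\<^sub>v v) = (?S * adj_mat ?S) *\<^sub>v v"
    by (rule assoc_mult_mat_vec[symmetric, OF S adj_mat(1)[OF S] v])
  ultimately have 0: "(det ?S \<cdot>\<^sub>m 1\<^sub>m (Suc d)) *\<^sub>v v = 0\<^sub>v (Suc d)"
    unfolding adj_mat(2)[OF S] by (simp only:)
  have "det ?S * g r = 0" if r: "r < Suc d" for r
  proof -
    let ?D = "det ?S \<cdot>\<^sub>m 1\<^sub>m (Suc d)"
    have "(?D *\<^sub>v v) $ r = (\<Sum>j\<in>{0..<Suc d}. row ?D r $ j * v $ j)"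
      using r v by (simp add: scalar_prod_def del: sum.op_ivl_Suc)
    also have "\<dots> = (\<Sum>j\<in>{0..<Suc d}. if j = r then det ?S * g j else 0)"
      by (rule sum.cong) (use r in \<open>auto simp: v_def\<close>)
    also have "\<dots> = det ?S * g r"
      using r by (simp del: sum.op_ivl_Suc)
    finally have "(?D *\<^sub>v v) $ r = det ?S * g r" .
    then show ?thesis using r unfolding 0 by (simp del: sum.lessThan_Suc)
  qed
  then show ?thesis using det by simp
qed

section \<open>Pluecker coordinates of the tropicalized space\<close>

lemma sum_fun_apply: "(\<Sum>x\<in>S. f x) i = (\<Sum>x\<in>S. f x i)"
  for f :: "'a \<Rightarrow> 'i \<Rightarrow> 'k::comm_monoid_add"
  by (induction S rule: infinite_finite_induct) auto

lemma in_span_list_iff: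
  fixes bs :: "('i \<Rightarrow> 'k::field) list"
  shows "x \<in> coord.span (set bs) \<longleftrightarrow> (\<exists>g. \<forall>i. x i = (\<Sum>r<length bs. g r * (bs ! r) i))"
proof
  assume "x \<in> coord.span (set bs)"
  then show "\<exists>g. \<forall>i. x i = (\<Sum>r<length bs. g r * (bs ! r) i)"
  proof (induction rule: coord.span_induct_alt)
    case base
    show ?case by (intro exI[of _ "\<lambda>_. 0"]) simp
  next
    case (step c b y)
    then obtain g where g: "\<And>i. y i = (\<Sum>r<length bs. g r * (bs ! r) i)" by blast
    obtain r0 where r0: "r0 < length bs" "bs ! r0 = b" using step.hyps by (metis in_set_conv_nth)
    have "(coord_scale c b + y) i = (\<Sum>r<length bs. (g r + (if r = r0 then c else 0)) * (bs ! r) i)" for i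
    proof -
      have "(\<Sum>r<length bs. (g r + (if r = r0 then c else 0)) * (bs ! r) i)
          = (\<Sum>r<length bs. g r * (bs ! r) i) + (\<Sum>r<length bs. if r = r0 then c * (bs ! r) i else 0)"
        unfolding sum.distrib[symmetric] by (rule sum.cong) (auto simp: algebra_simps)
      then show ?thesis using g r0 by (simp add: coord_scale_def)
    qed
    then show ?case
      by (intro exI[of _ "\<lambda>r. g r + (if r = r0 then c else 0)"] allI)
  qed
next
  assume "\<exists>g. \<forall>i. x i = (\<Sum>r<length bs. g r * (bs ! r) i)"
  then obtain g where g: "\<And>i. x i = (\<Sum>r<length bs. g r * (bs ! r) i)" by blast
  have "x = (\<Sum>r<length bs. coord_scale (g r) (bs ! r))"
    by (rule ext) (simp add: g sum_fun_apply coord_scale_def)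
  also have "\<dots> \<in> coord.span (set bs)"
    by (intro coord.span_sum coord.span_scale coord.span_base) simp
  finally show "x \<in> coord.span (set bs)" .
qed

lemma independent_list_iff:
  fixes bs :: "('i \<Rightarrow> 'k::field) list"
  shows "distinct bs \<and> coord.independent (set bs) \<longleftrightarrow>
     (\<forall>g. (\<forall>i. (\<Sum>r<length bs. g r * (bs ! r) i) = 0) \<longrightarrow> (\<forall>r<length bs. g r = 0))"
  (is "?L \<longleftrightarrow> ?R")
proof
  assume L: ?L
  have bij: "bij_betw ((!) bs) {..<length bs} (set bs)" using L by (auto intro: bij_betw_nth)
  define idx where "idx = the_inv_into {..<length bs} ((!) bs)"
  have idx: "idx (bs ! r) = r" if "r < length bs" for r
    using that bij by (auto simp: idx_def bij_betw_def intro!: the_inv_into_f_f)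
  show ?R
  proof (intro allI impI)
    fix g r assume g: "\<forall>i. (\<Sum>r<length bs. g r * (bs ! r) i) = 0" and r: "r < length bs"
    have "(\<Sum>b\<in>set bs. coord_scale (g (idx b)) b) = (\<Sum>r<length bs. coord_scale (g (idx (bs ! r))) (bs ! r))"
      using sum.reindex_bij_betw[OF bij, of "\<lambda>b. coord_scale (g (idx b)) b"] by simp
    also have "\<dots> = (\<Sum>r<length bs. coord_scale (g r) (bs ! r))"
      by (rule sum.cong) (auto simp: idx)
    also have "\<dots> = 0"
      by (rule ext) (use g in \<open>simp add: sum_fun_apply coord_scale_def\<close>)
    finally have "g (idx (bs ! r)) = 0"
      using L r by (intro coord.independentD[of "set bs" "set bs"]) auto
    then show "g r = 0" using idx[OF r] by simp
  qed
next
  assume R: ?R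
  have dist: "distinct bs"
  proof (rule ccontr)
    assume "\<not> distinct bs"
    then obtain a b where ab: "a < length bs" "b < length bs" "a \<noteq> b" "bs ! a = bs ! b"
      by (auto simp: distinct_conv_nth)
    let ?g = "\<lambda>r. if r = a then 1 else if r = b then -1 else 0 :: 'k"
    have "(\<Sum>r<length bs. ?g r * (bs ! r) i) = 0" for i
    proof -
      have "(\<Sum>r<length bs. ?g r * (bs ! r) i)
          = (\<Sum>r<length bs. (if r = a then (bs ! r) i else 0) - (if r = b then (bs ! r) i else 0))"
        by (rule sum.cong) (use ab(3) in auto)
      also have "\<dots> = 0" using ab by (simp add: sum_subtractf)
      finally show ?thesis .
    qed
    then have "\<forall>i. (\<Sum>r<length bs. ?g r * (bs ! r) i) = 0" ..
    from R[THEN spec, of ?g, THEN mp, OF this] have "?g a = 0" using ab(1) by blast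
    then show False by simp
  qed
  moreover have "coord.independent (set bs)"
  proof (rule coord.independent_if_scalars_zero)
    fix u b assume u: "(\<Sum>b\<in>set bs. coord_scale (u b) b) = 0" and b: "b \<in> set bs"
    have "(\<Sum>r<length bs. u (bs ! r) * (bs ! r) i) = 0" for i
    proof -
      have "(\<Sum>r<length bs. coord_scale (u (bs ! r)) (bs ! r)) = 0"
        using sum.reindex_bij_betw[OF bij_betw_nth[OF dist refl refl], of "\<lambda>b. coord_scale (u b) b"] u
        by simp
      from fun_cong[OF this, of i] show ?thesis by (simp add: sum_fun_apply coord_scale_def)
    qed
    then have "\<forall>i. (\<Sum>r<length bs. u (bs ! r) * (bs ! r) i) = 0" ..
    from R[THEN spec, of "\<lambda>r. u (bs ! r)", THEN mp, OF this]
    show "u b = 0" using b by (metis in_set_conv_nth)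
  qed simp
  ultimately show ?L ..
qed

locale linear_space =
  fixes d n :: nat and X :: "(nat \<Rightarrow> 'k::field) set" and as :: "(nat \<Rightarrow> 'k) list"
  assumes basis: "distinct as" "coord.independent (set as)" "coord.span (set as) = X"
    and len_as: "length as = Suc d"
    and X_coord: "X \<subseteq> coord_space {1..n}"
begin

abbreviation "A \<equiv> \<lambda>r. as ! r"

text \<open>
  Up to sign the Pluecker vector of the hyperplane of \<open>X\<close> spanned by all basis vectors except the
  one with index \<open>r\<close>. Its coordinate \<open>J\<close> is the entry \<open>r\<close> of the cofactor vector of
  \<open>J\<close>, so a coordinate functional of the cone is, in this basis, a cofactor vector.
\<close>

definition "cone_vec r = (\<lambda>J. if J \<in> nsets {1..n} d then cofactor_vec A n d J r else 0)"

definition "cone_basis = map cone_vec [0..<Suc d]"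

lemma length_cone_basis: "length cone_basis = Suc d" and nth_cone_basis: "r < Suc d \<Longrightarrow> cone_basis ! r = cone_vec r"
  by (simp_all add: cone_basis_def del: upt_Suc)

lemma A_family_independent:
  assumes "\<And>i. i \<in> {1..n} \<Longrightarrow> (\<Sum>r<Suc d. g r * A r i) = 0"
  shows "\<forall>r<Suc d. g r = 0"
proof -
  have "A r i = 0" if "r < Suc d" "i \<notin> {1..n}" for r i
  proof -
    have "A r \<in> X" using that len_as basis(3) by (metis coord.span_base nth_mem)
    then show ?thesis using X_coord that(2) by (auto simp: coord_space_def)
  qed
  then have "(\<Sum>r<Suc d. g r * A r i) = 0" for i
    using assms by (cases "i \<in> {1..n}") (simp_all del: sum.lessThan_Suc)
  then show ?thesis
    using basis(1,2) independent_list_iff[of as] unfolding len_as by blast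
qed

lemma cone_basis_independent: "distinct cone_basis" "coord.independent (set cone_basis)"
proof -
  have "\<forall>r<Suc d. g r = 0" if g: "\<forall>J. (\<Sum>r<Suc d. g r * (cone_basis ! r) J) = 0" for g
  proof (rule cofactor_vec_family_independent[where A = A and n = n])
    fix J assume J: "J \<in> nsets {1..n} d"
    have "(\<Sum>r<Suc d. g r * cofactor_vec A n d J r) = (\<Sum>r<Suc d. g r * (cone_basis ! r) J)"
      by (rule sum.cong) (use J nth_cone_basis in \<open>auto simp: cone_vec_def\<close>)
    then show "(\<Sum>r<Suc d. g r * cofactor_vec A n d J r) = 0" using g by simp
  qed (rule A_family_independent)
  then have "distinct cone_basis \<and> coord.independent (set cone_basis)"
    unfolding independent_list_iff length_cone_basis by blast
  then show "distinct cone_basis" "coord.independent (set cone_basis)" by auto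
qed

text \<open>
  A basis of a hyperplane of \<open>X\<close> is \<open>G A\<close> for a matrix \<open>G\<close> with \<open>d\<close> rows. By the Cauchy--Binet identity
  above, its maximal minors are the combinations of the cofactor vectors with the signed minors
  of \<open>G\<close> as coefficients.
\<close>

lemma L_cone_subset: "L_cone d n X \<subseteq> coord.span (set cone_basis)"
proof
  fix p assume "p \<in> L_cone d n X"
  then consider "p = 0" | Y where "Y \<in> Gr d n" "Y \<subseteq> X" "plucker_coords [1..<Suc n] Y p"
    by (auto simp: L_cone_def)
  then show "p \<in> coord.span (set cone_basis)"
  proof cases
    case 1
    then show ?thesis by (simp add: coord.span_zero)
  next
    case 2
    obtain bs where bs: "distinct bs" "coord.independent (set bs)" "coord.span (set bs) = Y"
      "p = maximal_minors [1..<Suc n] bs"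
      using 2(3) by (auto simp: plucker_coords_def)
    have "coord.dim Y = card (set bs)"
      using coord.dim_span_eq_card_independent[OF bs(2)] bs(3) by simp
    then have len: "length bs = d"
      using 2(1) distinct_card[OF bs(1)] by (simp add: Gr_def)
    have "\<exists>g. \<forall>j. (bs ! i) j = (\<Sum>r<Suc d. g r * A r j)" if "i < d" for i
    proof -
      have "bs ! i \<in> coord.span (set as)"
        using that len bs(3) 2(2) basis(3) by (metis coord.span_base nth_mem subsetD)
      then show ?thesis unfolding in_span_list_iff len_as .
    qed
    then obtain G where G: "\<And>i j. i < d \<Longrightarrow> (bs ! i) j = (\<Sum>r<Suc d. G i r * A r j)" by metis
    let ?c = "signed_minor d (\<lambda>j i. G i j)"
    have "p J = (\<Sum>r<length cone_basis. ?c r * (cone_basis ! r) J)" for J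
    proof (cases "J \<in> nsets {1..n} d")
      case True
      have "p J = det (mat d d (\<lambda>(i, j). \<Sum>r<Suc d. G i r * A r (elements_list n J ! j)))"
        using True unfolding bs(4) maximal_minors_def len elements_list_def
        by (simp add: atLeastLessThanSuc_atLeastAtMost del: upt_Suc sum.lessThan_Suc)
           (intro arg_cong[of _ _ det] eq_matI; simp add: G del: upt_Suc sum.lessThan_Suc)
      also have "\<dots> = (\<Sum>r<Suc d. cofactor_vec A n d J r * ?c r)"
        unfolding det_signed_minor_row[symmetric] cofactor_vec_def by (rule det_bordered_row)
      also have "\<dots> = (\<Sum>r<length cone_basis. ?c r * (cone_basis ! r) J)"
        unfolding length_cone_basis by (rule sum.cong) (use True nth_cone_basis in \<open>auto simp: cone_vec_def\<close>)
      finally show ?thesis .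
    next
      case False
      then have "p J = 0"
        unfolding bs(4) maximal_minors_def len
        by (simp add: atLeastLessThanSuc_atLeastAtMost del: upt_Suc)
      moreover have "(\<Sum>r<length cone_basis. ?c r * (cone_basis ! r) J) = 0"
        by (rule sum.neutral) (use False nth_cone_basis length_cone_basis in \<open>auto simp: cone_vec_def\<close>)
      ultimately show ?thesis by simp
    qed
    then show ?thesis unfolding in_span_list_iff by blast
  qed
qed

lemma cone_vec_in_L_cone:
  assumes r: "r < Suc d"
  shows "coord_scale ((-1) ^ r) (cone_vec r) \<in> L_cone d n X"
proof -
  define bs where "bs = map (\<lambda>i. as ! insert_index r i) [0..<d]"
  have len: "length bs = d" by (simp add: bs_def)
  have ins: "insert_index r i < length as" if "i < d" for i
    using that by (auto simp: insert_index_def len_as)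
  have inj: "a = b" if "insert_index r a = insert_index r b" for a b
    using that by (simp add: insert_index_def split: if_splits)
  have dist: "distinct bs"
    unfolding bs_def distinct_map
  proof (intro conjI inj_onI)
    fix a b assume ab: "a \<in> set [0..<d]" "b \<in> set [0..<d]"
      "as ! insert_index r a = as ! insert_index r b"
    then have "insert_index r a = insert_index r b"
      using ins basis(1) by (simp add: nth_eq_iff_index_eq)
    then show "a = b" by (rule inj)
  qed simp
  have sub: "set bs \<subseteq> set as" using ins by (auto simp: bs_def)
  have ind: "coord.independent (set bs)"
    using coord.independent_mono[OF basis(2) sub] .
  have Y: "coord.span (set bs) \<subseteq> X" using coord.span_mono[OF sub] basis(3) by simp
  have "coord.span (set bs) \<in> Gr d n"
    using order_trans[OF Y X_coord] coord.dim_span_eq_card_independent[OF ind] distinct_card[OF dist] len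
    unfolding Gr_def mem_Collect_eq by (simp add: coord.subspace_span)
  moreover have "plucker_coords [1..<Suc n] (coord.span (set bs)) (maximal_minors [1..<Suc n] bs)"
    unfolding plucker_coords_def by (intro exI[of _ bs] conjI dist ind refl)
  ultimately have "maximal_minors [1..<Suc n] bs \<in> L_cone d n X"
    unfolding L_cone_def using Y by (intro insertI2 CollectI bexI[of _ "coord.span (set bs)"] conjI)
  moreover have "maximal_minors [1..<Suc n] bs = coord_scale ((-1) ^ r) (cone_vec r)"
  proof
    fix J
    show "maximal_minors [1..<Suc n] bs J = coord_scale ((-1) ^ r) (cone_vec r) J"
    proof (cases "J \<in> nsets {1..n} d")
      case True
      have "maximal_minors [1..<Suc n] bs J
          = det (mat d d (\<lambda>(i, j). A (insert_index r i) (elements_list n J ! j)))"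
        using True unfolding maximal_minors_def len elements_list_def
        by (simp add: atLeastLessThanSuc_atLeastAtMost del: upt_Suc)
           (intro arg_cong[of _ _ det] eq_matI; simp add: bs_def del: upt_Suc)
      then show ?thesis
        using True by (simp add: coord_scale_def cone_vec_def cofactor_vec_def signed_minor_def flip: power_add mult.assoc)
    next
      case False
      then show ?thesis
        by (simp add: maximal_minors_def len coord_scale_def cone_vec_def atLeastLessThanSuc_atLeastAtMost del: upt_Suc)
    qed
  qed
  ultimately show ?thesis by simp
qed

text \<open>
  The generators lie in the cone, so being a subspace the cone contains their span.
  The hypothesis holds as soon as the cone has Pluecker coordinates.
\<close>

lemma L_cone_eq_span:
  assumes "coord.subspace (L_cone d n X)"
  shows "L_cone d n X = coord.span (set cone_basis)"
proof
  show "L_cone d n X \<subseteq> coord.span (set cone_basis)" by (rule L_cone_subset)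
  have "cone_vec r \<in> L_cone d n X" if "r < Suc d" for r
  proof -
    have "coord_scale ((-1) ^ r) (coord_scale ((-1) ^ r) (cone_vec r)) \<in> L_cone d n X"
      using assms cone_vec_in_L_cone[OF that] by (rule coord.subspace_scale)
    then show ?thesis by (simp add: coord_scale_def flip: power_add mult.assoc)
  qed
  then have "set cone_basis \<subseteq> L_cone d n X" by (auto simp: cone_basis_def)
  then show "coord.span (set cone_basis) \<subseteq> L_cone d n X"
    using assms by (rule coord.span_minimal)
qed

text \<open>
  Here \<open>\<gamma>\<close> is the determinant of the change of basis from the generators to the basis that
  defines \<open>p\<close>.
\<close>

lemma plucker_coords_L_cone:
  assumes es: "distinct es" "set es = nsets {1..n} d" and p: "plucker_coords es (L_cone d n X) p"
  shows "coord.dim (L_cone d n X) = Suc d"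
    and "\<exists>\<gamma>. \<forall>I\<in>nsets (nsets {1..n} d) (Suc d).
           p I = \<gamma> * ldet (cofactor_vec A n d) (filter (\<lambda>J. J \<in> I) es) [0..<Suc d]"
proof -
  obtain bs where bs: "distinct bs" "coord.independent (set bs)" "coord.span (set bs) = L_cone d n X"
    "p = maximal_minors es bs"
    using p by (auto simp: plucker_coords_def)
  have L: "L_cone d n X = coord.span (set cone_basis)"
    using bs(3) by (intro L_cone_eq_span) (metis coord.subspace_span)
  show dim: "coord.dim (L_cone d n X) = Suc d"
    unfolding L using coord.dim_span_eq_card_independent[OF cone_basis_independent(2)]
      distinct_card[OF cone_basis_independent(1)] length_cone_basis by simp
  have len: "length bs = Suc d"
    using dim coord.dim_span_eq_card_independent[OF bs(2)] distinct_card[OF bs(1)] bs(3) by simp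
  have "\<exists>g. \<forall>J. (bs ! i) J = (\<Sum>r<Suc d. g r * (cone_basis ! r) J)" if "i < Suc d" for i
  proof -
    have "bs ! i \<in> coord.span (set cone_basis)"
      using that len bs(3) L by (metis coord.span_base nth_mem)
    then show ?thesis unfolding in_span_list_iff length_cone_basis .
  qed
  then obtain G where G: "\<And>i J. i < Suc d \<Longrightarrow> (bs ! i) J = (\<Sum>r<Suc d. G i r * (cone_basis ! r) J)" by metis
  let ?G = "mat (Suc d) (Suc d) (\<lambda>(i, r). G i r)"
  have "p I = det ?G * ldet (cofactor_vec A n d) (filter (\<lambda>J. J \<in> I) es) [0..<Suc d]"
    if I: "I \<in> nsets (nsets {1..n} d) (Suc d)" for I
  proof -
    let ?Js = "filter (\<lambda>J. J \<in> I) es"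
    have I': "I \<subseteq> nsets {1..n} d" "card I = Suc d" using I by (auto simp: nsets_def)
    then have set: "set ?Js = I" using es(2) by auto
    then have lenJ: "length ?Js = Suc d"
      using I'(2) distinct_card[of ?Js] es(1) by simp
    let ?K = "mat (Suc d) (Suc d) (\<lambda>(r, j). cofactor_vec A n d (?Js ! j) r)"
    have K: "cofactor_vec A n d (?Js ! j) r = (cone_basis ! r) (?Js ! j)" if "r < Suc d" "j < Suc d" for r j
    proof -
      have "?Js ! j \<in> nsets {1..n} d" using nth_mem[of j ?Js] that(2) lenJ set I'(1) by auto
      then show ?thesis using that nth_cone_basis by (simp add: cone_vec_def)
    qed
    have "p I = det (mat (Suc d) (Suc d) (\<lambda>(i, j). (bs ! i) (?Js ! j)))"
      using I es(2) by (simp add: bs(4) maximal_minors_def len)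
    also have "mat (Suc d) (Suc d) (\<lambda>(i, j). (bs ! i) (?Js ! j)) = ?G * ?K"
    proof (rule eq_matI)
      fix i j assume "i < dim_row (?G * ?K)" "j < dim_col (?G * ?K)"
      then have ij: "i < Suc d" "j < Suc d" by auto
      have "(?G * ?K) $$ (i, j) = (\<Sum>r\<in>{0..<Suc d}. row ?G i $ r * col ?K j $ r)"
        using ij by (simp add: scalar_prod_def del: sum.op_ivl_Suc)
      also have "\<dots> = (\<Sum>r\<in>{0..<Suc d}. G i r * (cone_basis ! r) (?Js ! j))"
        by (rule sum.cong) (use ij in \<open>auto simp: K\<close>)
      finally show "mat (Suc d) (Suc d) (\<lambda>(i, j). (bs ! i) (?Js ! j)) $$ (i, j) = (?G * ?K) $$ (i, j)"
        using ij by (simp add: G atLeast0LessThan del: sum.lessThan_Suc)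
    qed auto
    also have "det (?G * ?K) = det ?G * det ?K"
      by (rule det_mult) auto
    also have "det ?K = ldet (\<lambda>r J. cofactor_vec A n d J r) [0..<Suc d] ?Js"
      unfolding ldet_def by (intro arg_cong[of _ _ det] eq_matI) (auto simp del: upt_Suc)
    also have "\<dots> = ldet (cofactor_vec A n d) ?Js [0..<Suc d]"
      by (rule ldet_transpose) (simp add: lenJ del: upt_Suc)
    finally show ?thesis .
  qed
  then show "\<exists>\<gamma>. \<forall>I\<in>nsets (nsets {1..n} d) (Suc d).
      p I = \<gamma> * ldet (cofactor_vec A n d) (filter (\<lambda>J. J \<in> I) es) [0..<Suc d]" by blast
qed

end

section \<open>Circuits of the Dilworth truncation\<close>

text \<open>
  Dependence of \<open>C\<close> and independence of \<open>C - {h}\<close> leave room for one value of \<open>card (\<Union>C)\<close> only, and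
  force \<open>C - {h}\<close> to cover the same vertices as \<open>C\<close>.
\<close>

lemma dilworth_circuit_Union:
  assumes "d < n" and C: "dilworth_circuit d n C" and h: "h \<in> C"
  shows "finite C" and "C - {h} \<noteq> {}" and "\<Union>(C - {h}) = \<Union>C"
    and "card (\<Union>C) = n - d - 1 + card (C - {h})"
proof -
  have sub: "C \<subseteq> nsets {1..n} (n - d)" using C by (simp add: dilworth_circuit_def)
  then show fin: "finite C" by (rule finite_subset) (simp add: finite_imp_finite_nsets)
  have finU: "finite (\<Union>C)" using sub fin by (auto simp: nsets_def)
  have "card h = n - d" using sub h by (auto simp: nsets_def)
  obtain G where G: "G \<subseteq> C" "G \<noteq> {}" "card (\<Union>G) < n - d - 1 + card G"
    using C sub by (auto simp: dilworth_circuit_def dilworth_indep_def not_le)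
  have "G = C"
  proof (rule ccontr)
    assume "G \<noteq> C"
    then have "dilworth_indep d n G" using C G(1) by (auto simp: dilworth_circuit_def)
    then show False using G(2,3) by (auto simp: dilworth_indep_def)
  qed
  then have less: "card (\<Union>C) < n - d - 1 + card C" using G by simp
  have Suc: "card C = Suc (card (C - {h}))" using card.remove[OF fin h] .
  show ne: "C - {h} \<noteq> {}"
  proof
    assume "C - {h} = {}"
    then have "C = {h}" using h by blast
    then show False using less \<open>card h = n - d\<close> \<open>d < n\<close> by simp
  qed
  have "C - {h} \<subset> C" using h by blast
  then have "dilworth_indep d n (C - {h})" using C unfolding dilworth_circuit_def by blast
  then have ge: "n - d - 1 + card (C - {h}) \<le> card (\<Union>(C - {h}))"
    using ne unfolding dilworth_indep_def by blast
  have sub': "\<Union>(C - {h}) \<subseteq> \<Union>C" by blast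
  have le: "card (\<Union>(C - {h})) \<le> card (\<Union>C)" using card_mono[OF finU sub'] .
  show eq: "card (\<Union>C) = n - d - 1 + card (C - {h})" using ge le less Suc by linarith
  show "\<Union>(C - {h}) = \<Union>C"
    using card_subset_eq[OF finU sub'] ge le eq by linarith
qed

text \<open>
  The union of \<open>d + 2\<close> members has at most \<open>n\<close> elements, one less than independence requires.
\<close>

lemma exists_dilworth_circuit:
  assumes "d < n" and I: "I \<subseteq> nsets {1..n} (n - d)" "card I = d + 2"
  obtains C where "C \<subseteq> I" and "dilworth_circuit d n C"
proof -
  have "card (\<Union>I) \<le> card {1..n}" by (rule card_mono) (use I(1) in \<open>auto simp: nsets_def\<close>)
  then have "\<not> dilworth_indep d n I"
    using I(2) \<open>d < n\<close> unfolding dilworth_indep_def by (auto intro!: exI[of _ I])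
  let ?D = "{F. F \<subseteq> I \<and> \<not> dilworth_indep d n F}"
  have "finite I" using I(2) by (intro card_ge_0_finite) simp
  then have "finite ?D" by simp
  moreover have "?D \<noteq> {}" using \<open>\<not> dilworth_indep d n I\<close> by blast
  ultimately obtain C where C: "C \<in> ?D" "\<And>F. F \<in> ?D \<Longrightarrow> F \<subseteq> C \<Longrightarrow> C = F"
    using finite_has_minimal[of ?D] by auto
  have "dilworth_indep d n F" if "F \<subset> C" for F
    using C(1) C(2)[of F] that by auto
  then have "dilworth_circuit d n C" using C(1) I(1) by (auto simp: dilworth_circuit_def)
  then show ?thesis using that C(1) by blast
qed

lemma ldet_map: "ldet M (map f hs) ts = ldet (\<lambda>h. M (f h)) hs ts"
  unfolding ldet_def by (intro arg_cong[of _ _ det] eq_matI) auto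

context linear_space
begin

definition "q = maximal_minors [1..<Suc n] as"

abbreviation "M \<equiv> circuit_entry n q"

text \<open>
  The circuit vector of \<open>h\<close> in the coordinates given by the basis \<open>as\<close>, whereas \<open>M h\<close> is the same vector
  in the coordinates of the ambient space.
\<close>

definition "circuit_vec h = cofactor_vec A n d ({1..n} - h)"

lemma sum_circuit_vec_column:
  assumes "d < n" and h: "h \<in> nsets {1..n} (n - d)" and i: "i \<in> {1..n}"
  shows "(\<Sum>r<Suc d. circuit_vec h r * A r i) = M h i"
proof -
  have h': "h \<subseteq> {1..n}" "card h = n - d" using h by (auto simp: nsets_def)
  then have J: "{1..n} - h \<in> nsets {1..n} d"
    using \<open>d < n\<close> by (auto simp: nsets_def card_Diff_subset finite_subset[OF h'(1)])
  show ?thesis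
  proof (cases "i \<in> h")
    case True
    let ?J = "{1..n} - (h - {i})"
    have eq: "insert i ({1..n} - h) = ?J" using True h' by auto
    have "card (h - {i}) = n - d - 1" using True h' by simp
    then have "card ?J = Suc d"
      using \<open>d < n\<close> h' by (simp add: card_Diff_subset finite_subset[OF h'(1)] subset_iff)
    then have "?J \<in> nsets {1..n} (Suc d)" by (simp add: nsets_def)
    then have "q ?J = ldet A [0..<Suc d] (elements_list n ?J)"
      unfolding q_def maximal_minors_def len_as ldet_def elements_list_def
      by (simp add: atLeastLessThanSuc_atLeastAtMost del: upt_Suc)
         (intro arg_cong[of _ _ det] eq_matI; simp del: upt_Suc)
    then show ?thesis
      using sum_cofactor_vec_column[OF J i, of A] True unfolding circuit_vec_def eq circuit_entry_def
      by (simp del: sum.lessThan_Suc upt_Suc)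
  next
    case False
    then show ?thesis
      using sum_cofactor_vec_column[OF J i, of A] i unfolding circuit_vec_def circuit_entry_def
      by (simp del: sum.lessThan_Suc upt_Suc)
  qed
qed

text \<open>
  Determinants of \<open>d + 1\<close> circuit vectors are determinants of \<open>d\<close> of them, restricted to the coordinates
  outside the support \<open>e\<close> of the remaining one. Since this is a polynomial identity, it also
  covers the case that the circuit vector of \<open>e\<close> vanishes.
\<close>

lemma ldet_circuit_vec_Cons:
  assumes "d < n" and e: "e \<in> nsets {1..n} (n - d)" and hs: "set hs \<subseteq> nsets {1..n} (n - d)"
    and len: "length hs = d"
  shows "ldet circuit_vec (e # hs) [0..<Suc d] = ldet M hs (elements_list n ({1..n} - e))"
proof -
  let ?cs = "elements_list n ({1..n} - e)"
  have e': "e \<subseteq> {1..n}" "card e = n - d" using e by (auto simp: nsets_def)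
  have lencs: "length ?cs = d"
    using \<open>d < n\<close> e' by (simp add: length_elements_list card_Diff_subset finite_subset[OF e'(1)])
  have "ldet circuit_vec (e # hs) [0..<Suc d]
      = det (mat (Suc d) (Suc d) (\<lambda>(i, j). if i = 0
          then signed_minor d (\<lambda>r j. A r (?cs ! j)) j else circuit_vec (hs ! (i - 1)) j))"
    unfolding ldet_def by (intro arg_cong[of _ _ det] eq_matI)
      (auto simp: len circuit_vec_def cofactor_vec_def nth_Cons' simp del: upt_Suc)
  also have "\<dots> = det (mat d d (\<lambda>(i, j). \<Sum>r<Suc d. circuit_vec (hs ! i) r * A r (?cs ! j)))"
    by (rule det_signed_minor_row)
  also have "\<dots> = ldet M hs ?cs"
    unfolding ldet_def len
  proof (intro arg_cong[of _ _ det] cong_mat refl)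
    fix i j assume ij: "i < d" "j < d"
    have "?cs ! j \<in> {1..n}" using nth_mem[of j ?cs] lencs ij(2) set_elements_list[of "{1..n} - e" n] by auto
    moreover have "hs ! i \<in> nsets {1..n} (n - d)" using hs len ij(1) by auto
    ultimately show "(case (i, j) of (i, j) \<Rightarrow> \<Sum>r<Suc d. circuit_vec (hs ! i) r * A r (?cs ! j))
        = (case (i, j) of (i, j) \<Rightarrow> M (hs ! i) (?cs ! j))"
      using sum_circuit_vec_column[OF \<open>d < n\<close>] by (simp del: sum.lessThan_Suc)
  qed
  finally show ?thesis .
qed

lemma M_outside: "h \<in> C \<Longrightarrow> i \<notin> \<Union>C \<Longrightarrow> M h i = 0"
  by (auto simp: circuit_entry_def)

text \<open>
  Vectors of hyperedges in \<open>C\<close> vanish outside \<open>\<Union>C\<close>, and \<open>\<Union>C - e\<close> has \<open>card C - 2\<close> elements. Hence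
  the matrix is block triangular with a square upper left block once \<open>card C - 2\<close> of its rows come
  from \<open>C\<close>.
\<close>

lemma ldet_circuit_vec_split:
  assumes "d < n" and I: "I \<subseteq> nsets {1..n} (n - d)" "card I = d + 2"
    and C: "dilworth_circuit d n C" "C \<subseteq> I"
    and g: "g \<in> I" and hs: "distinct hs" "set hs = I - {g}"
    and e: "e \<in> C - {g}"
    and rows: "distinct (xs @ ys)" "set (xs @ ys) = I - {g} - {e}" "set xs \<subseteq> C" "length xs = card C - 2"
    and vs: "distinct vs" "set vs = \<Union>C - e" and us: "distinct us" "set us = {1..n} - \<Union>C"
  shows "ldet circuit_vec hs [0..<Suc d] \<simeq> ldet M xs vs * ldet M ys us"
    and "length vs = length xs" and "length us = length ys"
proof -
  have eC: "e \<in> C" "e \<noteq> g" using e by auto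
  note U = dilworth_circuit_Union[OF \<open>d < n\<close> C(1) eC(1)]
  have e': "e \<in> nsets {1..n} (n - d)" using eC C(2) I(1) by auto
  then have e'': "e \<subseteq> {1..n}" "card e = n - d" "finite e" by (auto simp: nsets_def)
  have fin: "finite I" using I(2) by (intro card_ge_0_finite) simp
  have cardC: "card C = Suc (card (C - {e}))" by (rule card.remove[OF U(1) eC(1)])
  have pos: "card (C - {e}) > 0" using U(1,2) by (simp add: card_gt_0_iff)
  have Usub: "\<Union>C \<subseteq> {1..n}" using C(2) I(1) by (auto simp: nsets_def)
  have "card (\<Union>C - e) = card (\<Union>C) - card e"
    using e''(3) eC(1) by (intro card_Diff_subset) auto
  then have "length vs = card (\<Union>C) - card e"
    using distinct_card[OF vs(1)] vs(2) by simp
  then show lenv: "length vs = length xs"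
    using U(4) e''(2) rows(4) cardC pos \<open>d < n\<close> by simp
  have "card (I - {g} - {e}) = d" using g eC subsetD[OF C(2) eC(1)] I(2) by simp
  then have lenr: "length xs + length ys = d"
    using distinct_card[OF rows(1)] rows(2) by simp
  have "length us = n - card (\<Union>C)"
    using distinct_card[OF us(1)] us(2) Usub by (simp add: card_Diff_subset finite_subset[OF Usub])
  then show lenu: "length us = length ys"
    using U(4) rows(4) cardC pos lenr \<open>d < n\<close> by simp
  have "ldet circuit_vec hs [0..<Suc d] \<simeq> ldet circuit_vec (e # (xs @ ys)) [0..<Suc d]"
  proof (rule ldet_reorder_rows)
    have "distinct (e # (xs @ ys))" using rows(1,2) by simp
    moreover have "set hs = set (e # (xs @ ys))"
      unfolding list.set(2) rows(2) hs(2) using eC C(2) by blast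
    ultimately show "mset hs = mset (e # (xs @ ys))"
      using hs(1) by (simp only: set_eq_iff_mset_eq_distinct)
  qed
  also have "\<dots> = ldet M (xs @ ys) (elements_list n ({1..n} - e))"
  proof (rule ldet_circuit_vec_Cons[OF \<open>d < n\<close> e'])
    show "set (xs @ ys) \<subseteq> nsets {1..n} (n - d)" unfolding rows(2) using I(1) by blast
    show "length (xs @ ys) = d" using lenr by simp
  qed
  also have "\<dots> \<simeq> ldet M (xs @ ys) (vs @ us)"
  proof (rule ldet_reorder)
    have "distinct (vs @ us)"
      unfolding distinct_append vs(2) us(2) using vs(1) us(1) by blast
    moreover have "set (elements_list n ({1..n} - e)) = set (vs @ us)"
      unfolding set_append vs(2) us(2) set_elements_list[OF Diff_subset] using Usub eC(1) by blast
    ultimately show "mset (elements_list n ({1..n} - e)) = mset (vs @ us)"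
      by (simp only: set_eq_iff_mset_eq_distinct distinct_elements_list)
    then show "length (elements_list n ({1..n} - e)) = length (xs @ ys)"
      using lenv lenu by (metis length_append mset_eq_length)
  qed simp
  also have "\<dots> = ldet M xs vs * ldet M ys us"
  proof (rule ldet_block)
    fix h i assume "h \<in> set xs" "i \<in> set us"
    then show "M h i = 0" using rows(3) us(2) by (intro M_outside[of h C]) auto
  qed (rule lenv, rule lenu)
  finally show "ldet circuit_vec hs [0..<Suc d] \<simeq> ldet M xs vs * ldet M ys us" .
qed

text \<open>
  All of \<open>C\<close> remains, so after removing \<open>e\<close> one more member \<open>x\<close> of \<open>C\<close> is available than the upper left
  block has rows. It gives a zero row in the lower right block.
\<close>

lemma ldet_circuit_vec_outside_circuit:
  assumes "d < n" and I: "I \<subseteq> nsets {1..n} (n - d)" "card I = d + 2"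
    and C: "dilworth_circuit d n C" "C \<subseteq> I"
    and g: "g \<in> I - C" and hs: "distinct hs" "set hs = I - {g}"
  shows "ldet circuit_vec hs [0..<Suc d] = 0"
proof -
  have "C \<noteq> {}"
    using C(1) by (auto simp: dilworth_circuit_def dilworth_indep_def)
  then obtain e where e: "e \<in> C" by blast
  note U = dilworth_circuit_Union[OF \<open>d < n\<close> C(1) e]
  obtain x where x: "x \<in> C - {e}" using U(2) by blast
  have fin: "finite I" using I(2) by (intro card_ge_0_finite) simp
  obtain xs where xs: "set xs = C - {e} - {x}" "distinct xs"
    using finite_distinct_list[of "C - {e} - {x}"] U(1) by auto
  obtain ds where ds: "set ds = I - {g} - C" "distinct ds"
    using finite_distinct_list[of "I - {g} - C"] fin by auto
  have "\<Union>C \<subseteq> {1..n}" using C(2) I(1) by (auto simp: nsets_def)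
  from finite_subset[OF this] have "finite (\<Union>C - e)" by simp
  from finite_distinct_list[OF this]
  obtain vs where vs: "set vs = \<Union>C - e" "distinct vs" by blast
  obtain us where us: "set us = {1..n} - \<Union>C" "distinct us"
    using finite_distinct_list[of "{1..n} - \<Union>C"] by auto
  have lenx: "length xs = card C - 2"
    using distinct_card[OF xs(2)] xs(1) x e U(1) by (simp add: card_Diff_subset)
  have dist: "distinct (xs @ x # ds)" using xs ds x by auto
  have set: "set (xs @ x # ds) = I - {g} - {e}" using xs ds x e g C(2) by auto
  have gI: "g \<in> I" and e': "e \<in> C - {g}" and xsC: "set xs \<subseteq> C" using g e xs by auto
  note S = ldet_circuit_vec_split[OF \<open>d < n\<close> I C gI hs e' dist set xsC lenx vs(2,1) us(2,1)]
  have "ldet M (x # ds) us = 0"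
  proof (rule ldet_zero_row)
    show "M x i = 0" if "i \<in> set us" for i
      using that us(1) x by (intro M_outside[of x C]) auto
  qed (use S(3) in auto)
  then show ?thesis using up_to_sign_0_iff[OF S(1)] by simp
qed

text \<open>
  The factor in front, a minor for the rows outside \<open>C\<close> and the columns outside \<open>\<Union>C\<close>, is the same for
  all \<open>h\<close>, \<open>e\<close> and \<open>J\<close>. It supplies the tropical scaling.
\<close>

lemma ldet_circuit_vec_eq_orientation_sum:
  assumes "d < n" and I: "I \<subseteq> nsets {1..n} (n - d)" "card I = d + 2"
    and C: "dilworth_circuit d n C" "C \<subseteq> I"
    and h: "h \<in> C" and hs: "distinct hs" "set hs = I - {h}"
    and e: "e \<in> C - {h}" and J: "J \<subset> e" "card J = n - d - 1"
    and ds: "distinct ds" "set ds = I - C" and us: "distinct us" "set us = {1..n} - \<Union>C"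
  shows "ldet circuit_vec hs [0..<Suc d] \<simeq> ldet M ds us * orientation_sum n q (C - {h}) e J"
proof -
  note U = dilworth_circuit_Union[OF \<open>d < n\<close> C(1) h]
  have fin: "finite I" using I(2) by (intro card_ge_0_finite) simp
  obtain xs where xs: "set xs = C - {h} - {e}" "distinct xs"
    using finite_distinct_list[of "C - {h} - {e}"] U(1) by auto
  have "\<Union>C \<subseteq> {1..n}" using C(2) I(1) by (auto simp: nsets_def)
  from finite_subset[OF this] have "finite (\<Union>C - e)" by simp
  from finite_distinct_list[OF this]
  obtain vs where vs: "set vs = \<Union>C - e" "distinct vs" by blast
  have lenx: "length xs = card C - 2"
    using distinct_card[OF xs(2)] xs(1) e h U(1) by (simp add: card_Diff_subset)
  have dist: "distinct (xs @ ds)" using xs ds by auto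
  have set: "set (xs @ ds) = I - {h} - {e}" using xs ds e h C(2) by auto
  have hI: "h \<in> I" and xsC: "set xs \<subseteq> C" using h C(2) xs by auto
  have "ldet circuit_vec hs [0..<Suc d] \<simeq> ldet M xs vs * ldet M ds us"
    by (rule ldet_circuit_vec_split(1)[OF \<open>d < n\<close> I C hI hs e dist set xsC lenx vs(2,1) us])
  also have "\<dots> = ldet M ds us * ldet M xs vs" by simp
  also have "\<dots> \<simeq> ldet M ds us * orientation_sum n q (C - {h}) e J"
  proof (rule up_to_sign_mult[OF up_to_sign_refl up_to_sign_sym], rule orientation_sum_eq_ldet)
    show "C - {h} \<subseteq> nsets {1..n} (n - d)" using C(2) I(1) by auto
    show "card (\<Union>(C - {h})) = n - d - 1 + card (C - {h})" using U by simp
    show "set vs = \<Union>(C - {h}) - e" using vs U by simp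
  qed (use U xs vs e J in auto)
  finally show ?thesis .
qed

end

section \<open>Valuations and tropical forms\<close>

lemma valuation_uminus:
  assumes "nonarch_valuation v"
  shows "v (- a) = v a"
proof -
  have mult: "v (a * b) = v a + v b" and fin: "v a \<noteq> -\<infinity>" "v a = \<infinity> \<longleftrightarrow> a = 0" for a b
    using assms by (auto simp: nonarch_valuation_def)
  have 1: "v 1 = 0"
    using mult[of 1 1] fin[of 1] by (cases "v 1") auto
  have "v (-1) + v (-1) = 0" using mult[of "-1" "-1"] 1 by simp
  then have "v (-1) = 0" using fin[of "-1"] by (cases "v (-1)") auto
  then show ?thesis using mult[of "-1" a] by simp
qed

lemma valuation_up_to_sign: "nonarch_valuation v \<Longrightarrow> a \<simeq> b \<Longrightarrow> v a = v b"
  by (auto simp: up_to_sign_def valuation_uminus)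

lemma INF_add_real: "(INF i\<in>S. ereal c + g i) = ereal c + (INF i\<in>S. g i)"
proof (rule antisym)
  have cancel: "ereal (- c) + (ereal c + y) = y" "ereal c + (ereal (- c) + y) = y" for y
    by (cases y; simp)+
  have "ereal (- c) + (INF i\<in>S. ereal c + g i) \<le> (INF i\<in>S. g i)"
  proof (rule INF_greatest)
    fix i assume "i \<in> S"
    then have "ereal (- c) + (INF i\<in>S. ereal c + g i) \<le> ereal (- c) + (ereal c + g i)"
      by (intro add_left_mono INF_lower)
    then show "ereal (- c) + (INF i\<in>S. ereal c + g i) \<le> g i" unfolding cancel .
  qed
  from add_left_mono[OF this, of "ereal c"]
  show "(INF i\<in>S. ereal c + g i) \<le> ereal c + (INF i\<in>S. g i)" unfolding cancel .
  show "ereal c + (INF i\<in>S. g i) \<le> (INF i\<in>S. ereal c + g i)"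
    by (intro INF_greatest add_left_mono INF_lower)
qed

lemma trop_form_restrict_support:
  assumes "T \<subseteq> S" and "\<And>j. j \<in> S - T \<Longrightarrow> a j = \<infinity>"
  shows "trop_form S a = trop_form T a"
proof
  fix x
  have "(INF j\<in>T. a j + x j) \<le> a j + x j" if "j \<in> S" for j
    using that assms(2)[of j] by (cases "j \<in> T") (auto intro: INF_lower)
  then show "trop_form S a x = trop_form T a x"
    unfolding trop_form_def using assms(1)
    by (intro antisym INF_greatest INF_superset_mono) auto
qed

theorem proposition36:
  fixes v :: "'k::alg_closed_field \<Rightarrow> ereal"
    and n d :: nat
    and X :: "(nat \<Rightarrow> 'k) set"
    and q :: "nat set \<Rightarrow> 'k"
    and f :: "(nat set \<Rightarrow> ereal) \<Rightarrow> ereal"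
  assumes "nonarch_valuation v" and "nontrivial_valuation v"
    and "1 \<le> d" and "d \<le> n - 1"
    and "X \<in> Gr (d + 1) n"
    and "plucker_coords [1..<Suc n] X q"
    and "f \<in> valuated_circuits v (nsets {1..n} d) (L_cone d n X)"
  shows "\<exists>C. dilworth_circuit d n C \<and>
           (\<exists>c::real. \<forall>eh Ih. admissible_choice d n C eh Ih \<longrightarrow>
              f = (\<lambda>x. ereal c + circuit_form v n q C eh Ih x))"
proof -
  obtain as where as: "distinct as" "coord.independent (set as)" "coord.span (set as) = X"
    "q = maximal_minors [1..<Suc n] as"
    using assms(6) by (auto simp: plucker_coords_def)
  have "length as = Suc d"
    using coord.dim_span_eq_card_independent[OF as(2)] distinct_card[OF as(1)] as(3) assms(5)
    by (simp add: Gr_def)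
  moreover have "X \<subseteq> coord_space {1..n}" using assms(5) by (simp add: Gr_def)
  ultimately interpret S: linear_space d n X as
    by unfold_locales (rule as)+
  have q: "S.q = q" by (simp add: S.q_def as(4))
  have dn: "d < n" using assms(3,4) by simp
  obtain es p I where es: "distinct es" "set es = nsets {1..n} d" "plucker_coords es (L_cone d n X) p"
    and I: "I \<in> nsets (nsets {1..n} d) (coord.dim (L_cone d n X) + 1)"
    and f: "f = trop_form I (\<lambda>j. v (p (I - {j})))" and f_fin: "f \<noteq> (\<lambda>x. \<infinity>)"
    using assms(7) by (auto simp: valuated_circuits_def)
  (* Coordinates of the cone are indexed by d-subsets, hyperedges are their complements. *)
  let ?co = "\<lambda>J. {1..n} - J"
  have I_sub: "I \<subseteq> nsets {1..n} d" and card_I: "card I = d + 2" and fin_I: "finite I"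
    using I S.plucker_coords_L_cone(1)[OF es] by (auto simp: nsets_def)
  have co_co: "?co (?co J) = J" if "J \<in> I" for J
    using that I_sub by (auto simp: nsets_def)
  have inj_co: "inj_on ?co I" by (rule inj_on_inverseI[where g = ?co]) (rule co_co)
  define I' where "I' = ?co ` I"
  have I': "I' \<subseteq> nsets {1..n} (n - d)" "card I' = d + 2"
  proof -
    show "card I' = d + 2" unfolding I'_def card_image[OF inj_co] by (rule card_I)
    have "?co J \<in> nsets {1..n} (n - d)" if "J \<in> I" for J
    proof -
      have "J \<subseteq> {1..n}" "card J = d" "finite J" using that I_sub by (auto simp: nsets_def)
      then show ?thesis by (simp add: nsets_def card_Diff_subset)
    qed
    then show "I' \<subseteq> nsets {1..n} (n - d)" by (auto simp: I'_def)
  qed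
  obtain C where C: "C \<subseteq> I'" "dilworth_circuit d n C"
    using exists_dilworth_circuit[OF dn I'] .
  obtain ds where ds: "set ds = I' - C" "distinct ds"
    using finite_distinct_list[of "I' - C"] fin_I by (auto simp: I'_def)
  obtain us where us: "set us = {1..n} - \<Union>C" "distinct us"
    using finite_distinct_list[of "{1..n} - \<Union>C"] by auto
  obtain \<gamma> where \<gamma>: "\<And>I\<^sub>0. I\<^sub>0 \<in> nsets (nsets {1..n} d) (Suc d) \<Longrightarrow>
      p I\<^sub>0 = \<gamma> * ldet (cofactor_vec S.A n d) (filter (\<lambda>J. J \<in> I\<^sub>0) es) [0..<Suc d]"
    using S.plucker_coords_L_cone(2)[OF es] by blast
  have p: "\<exists>hs. distinct hs \<and> set hs = I' - {?co J} \<and> p (I - {J}) = \<gamma> * ldet S.circuit_vec hs [0..<Suc d]"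
    if J: "J \<in> I" for J
  proof -
    let ?Js = "filter (\<lambda>J'. J' \<in> I - {J}) es"
    have set: "set ?Js = I - {J}" using es(2) I_sub by auto
    have "I - {J} \<in> nsets (nsets {1..n} d) (Suc d)"
      using J I_sub card_I fin_I by (auto simp: nsets_def)
    then have "p (I - {J}) = \<gamma> * ldet (cofactor_vec S.A n d) ?Js [0..<Suc d]" by (rule \<gamma>)
    also have "map ?co (map ?co ?Js) = ?Js"
      unfolding map_map by (rule map_idI) (use set co_co in simp)
    then have "ldet (cofactor_vec S.A n d) ?Js [0..<Suc d] = ldet (cofactor_vec S.A n d) (map ?co (map ?co ?Js)) [0..<Suc d]"
      by (simp only:)
    also have "\<dots> = ldet S.circuit_vec (map ?co ?Js) [0..<Suc d]"
      unfolding ldet_map[of _ ?co "map ?co ?Js"] S.circuit_vec_def ..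
    finally have "p (I - {J}) = \<gamma> * ldet S.circuit_vec (map ?co ?Js) [0..<Suc d]" .
    moreover have "distinct (map ?co ?Js)"
      using es(1) set inj_on_subset[OF inj_co, of "I - {J}"] unfolding distinct_map by auto
    moreover have "set (map ?co ?Js) = I' - {?co J}"
      unfolding set_map set I'_def using inj_on_image_set_diff[OF inj_co, of I "{J}"] J by simp
    ultimately show ?thesis by blast
  qed
  let ?\<delta> = "ldet S.M ds us"
  have p_circuit: "p (I - {?co h}) \<simeq> (\<gamma> * ?\<delta>) * orientation_sum n q (C - {h}) e J"
    if h: "h \<in> C" and e: "e \<in> C - {h}" and J: "J \<subset> e" "card J = n - d - 1" for h e J
  proof -
    have hI: "?co h \<in> I" "?co (?co h) = h" using h C(1) co_co by (auto simp: I'_def)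
    obtain hs where hs: "distinct hs" "set hs = I' - {h}" "p (I - {?co h}) = \<gamma> * ldet S.circuit_vec hs [0..<Suc d]"
      using p[OF hI(1)] unfolding hI(2) by blast
    have "ldet S.circuit_vec hs [0..<Suc d] \<simeq> ?\<delta> * orientation_sum n q (C - {h}) e J"
      using S.ldet_circuit_vec_eq_orientation_sum[OF dn I' C(2,1) h hs(1,2) e J ds(2,1) us(2,1)]
      unfolding q .
    then show ?thesis
      unfolding hs(3) mult.assoc by (intro up_to_sign_mult up_to_sign_refl)
  qed
  have p_outside: "p (I - {J}) = 0" if "J \<in> I - ?co ` C" for J
  proof -
    have J: "J \<in> I" "?co J \<in> I' - C"
      using that co_co by (auto simp: I'_def) (metis image_eqI co_co)
    obtain hs where hs: "distinct hs" "set hs = I' - {?co J}" "p (I - {J}) = \<gamma> * ldet S.circuit_vec hs [0..<Suc d]"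
      using p[OF J(1)] by blast
    then show ?thesis
      using S.ldet_circuit_vec_outside_circuit[OF dn I' C(2,1) J(2) hs(1,2)] by simp
  qed
  have v: "v a \<noteq> -\<infinity>" "v a = \<infinity> \<longleftrightarrow> a = 0" "v (a * b) = v a + v b" for a b
    using assms(1) by (auto simp: nonarch_valuation_def)
  have co_C: "?co ` C \<subseteq> I" using C(1) co_co by (auto simp: I'_def)
  have f_eq: "f x = (INF h\<in>C. v (p (I - {?co h})) + x (?co h))" for x
  proof -
    have "f = trop_form (?co ` C) (\<lambda>j. v (p (I - {j})))"
      unfolding f by (rule trop_form_restrict_support[OF co_C]) (use p_outside v(2) in simp)
    then show ?thesis by (simp add: trop_form_def image_image)
  qed
  (* Otherwise all coefficients of f would be infinite. *)
  have "\<gamma> * ?\<delta> \<noteq> 0"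
  proof
    assume 0: "\<gamma> * ?\<delta> = 0"
    have "v (p (I - {?co h})) = \<infinity>" if h: "h \<in> C" for h
    proof -
      obtain e where e: "e \<in> C - {h}"
        using dilworth_circuit_Union(2)[OF dn C(2) h] by blast
      have "card e = n - d" "finite e" using e C(1) I'(1) by (auto simp: nsets_def)
      then obtain i where i: "i \<in> e" using dn by fastforce
      have "e - {i} \<subset> e" "card (e - {i}) = n - d - 1"
        using i \<open>card e = n - d\<close> by auto
      from up_to_sign_0_iff[OF p_circuit[OF h e this]] show ?thesis
        using 0 v(2) by simp
    qed
    then have "\<infinity> \<le> f x" for x unfolding f_eq by (intro INF_greatest) simp
    then have "f x = \<infinity>" for x by simp
    then show False using f_fin by blast
  qed
  then obtain c where c: "v (\<gamma> * ?\<delta>) = ereal c"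
    using v(1,2)[of "\<gamma> * ?\<delta>"] by (cases "v (\<gamma> * ?\<delta>)") auto
  have "f = (\<lambda>x. ereal c + circuit_form v n q C eh Ih x)" if adm: "admissible_choice d n C eh Ih" for eh Ih
  proof
    fix x
    have "v (p (I - {?co h})) = ereal c + v (orientation_sum n q (C - {h}) (eh h) (Ih h))" if h: "h \<in> C" for h
    proof -
      have "eh h \<in> C - {h}" "Ih h \<subset> eh h" "card (Ih h) = n - d - 1"
        using adm h unfolding admissible_choice_def by blast+
      from valuation_up_to_sign[OF assms(1) p_circuit[OF h this]]
      show ?thesis by (simp add: v(3) c[symmetric])
    qed
    then have "f x = (INF h\<in>C. ereal c + (v (orientation_sum n q (C - {h}) (eh h) (Ih h)) + x (?co h)))"
      unfolding f_eq by (intro INF_cong) (simp_all add: add.assoc)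
    then show "f x = ereal c + circuit_form v n q C eh Ih x"
      unfolding INF_add_real by (simp add: circuit_form_def trop_form_def)
  qed
  then show ?thesis using C(2) by blast
qed

end
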